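(* Let $n\ge1$, $\alpha\in(0,1)$ and $p\in\left[1,\frac{n}{n-\alpha}\right)$. If $f\in BV^{\alpha,p}_+(\mathbb{R}^n)$, then $$\frac{\mu_{1,\alpha}}{\alpha}\int_{\mathbb{R}^n}\frac{f(x)}{|(x-x_0)\cdot\nu|^\alpha}\,dx\le|D^\alpha f|\big(\overline{H_\nu^+(x_0)}\big)$$ for all $x_0\in\mathbb{R}^n$ and $\nu\in\mathbb{S}^{n-1}$.
   Context: Let $\mu_{n,\alpha}=2^{\alpha}\pi^{-n/2}\,\Gamma\left(\frac{n+\alpha+1}{2}\right)/\Gamma\left(\frac{1-\alpha}{2}\right)$. For $\varphi\in \mathrm{Lip}_c(\mathbb{R}^n;\mathbb{R}^n)$ (compactly supported Lipschitz), the fractional $\alpha$-divergence is $$\mathrm{div}^\alpha\varphi(x)=\mu_{n,\alpha}\int_{\mathbb{R}^n}\frac{(y-x)\cdot(\varphi(y)-\varphi(x))}{|y-x|^{n+\alpha+1}}\,dy,\quad x\in\mathbb{R}^n.$$ For $p\in[1,+\infty]$ and $f\in L^p(\mathbb{R}^n)$ let $$|D^\alpha f|(\mathbb{R}^n)=\sup\left\{\int_{\mathbb{R}^n} f\,\mathrm{div}^\alpha\varphi\,dx:\varphi\in C^\infty_c(\mathbb{R}^n;\mathbb{R}^n),\ \|\varphi\|_{L^\infty(\mathbb{R}^n;\mathbb{R}^n)}\le1\right\},$$ $BV^{\alpha,p}(\mathbb{R}^n)=\{f\in L^p(\mathbb{R}^n):|D^\alpha f|(\mathbb{R}^n)<+\infty\}$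 and $BV^{\alpha,p}_+(\mathbb{R}^n)=\{f\in BV^{\alpha,p}(\mathbb{R}^n):f\ge0\}$. A function $f\in L^p(\mathbb{R}^n)$ belongs to $BV^{\alpha,p}(\mathbb{R}^n)$ if and only if there is a (unique) finite $\mathbb{R}^n$-valued Radon measure $D^\alpha f$ on $\mathbb{R}^n$ with $\int_{\mathbb{R}^n} f\,\mathrm{div}^\alpha\varphi\,dx=-\int_{\mathbb{R}^n}\varphi\cdot dD^\alpha f$ for all $\varphi\in \mathrm{Lip}_c(\mathbb{R}^n;\mathbb{R}^n)$; $|D^\alpha f|$ denotes its total variation measure. For $\nu\in\mathbb{S}^{n-1}$ and $x_0\in\mathbb{R}^n$, $H_\nu^+(x_0)=\{y\in\mathbb{R}^n:(y-x_0)\cdot\nu>0\}$. *)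

theory Defs
  imports "HOL-Analysis.Analysis"
begin

section \<open>Test fields\<close>

definition compactly_supported :: "('a::topological_space \<Rightarrow> 'b::zero) \<Rightarrow> bool" where
  "compactly_supported \<phi> \<longleftrightarrow> compact (closure {x. \<phi> x \<noteq> 0})"

definition Lip_c :: "('a::euclidean_space \<Rightarrow> 'a) set" where
  "Lip_c = {\<phi>. (\<exists>L. L-lipschitz_on UNIV \<phi>) \<and> compactly_supported \<phi>}"

primrec C_k :: "nat \<Rightarrow> ('a::real_normed_vector \<Rightarrow> 'b::real_normed_vector) \<Rightarrow> bool" where
  "C_k 0 \<phi> \<longleftrightarrow> continuous_on UNIV \<phi>"
| "C_k (Suc k) \<phi> \<longleftrightarrow>
     (\<forall>x. \<phi> differentiable (at x)) \<and> (\<forall>v. C_k k (\<lambda>x. frechet_derivative \<phi> (at x) v))"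

definition C_infinity_c :: "('a::euclidean_space \<Rightarrow> 'a) set" where
  "C_infinity_c = {\<phi>. (\<forall>k. C_k k \<phi>) \<and> compactly_supported \<phi>}"

section \<open>Fractional divergence and functions of bounded fractional variation\<close>

definition frac_const :: "nat \<Rightarrow> real \<Rightarrow> real" where
  "frac_const n \<alpha> =
     2 powr \<alpha> * pi powr (- real n / 2) * Gamma ((real n + \<alpha> + 1) / 2) / Gamma ((1 - \<alpha>) / 2)"

definition frac_div :: "real \<Rightarrow> ('a::euclidean_space \<Rightarrow> 'a) \<Rightarrow> 'a \<Rightarrow> real" where
  "frac_div \<alpha> \<phi> x =
     frac_const DIM('a) \<alpha> *
     (LINT y|lebesgue. (y - x) \<bullet> (\<phi> y - \<phi> x) / norm (y - x) powr (real DIM('a) + \<alpha> + 1))"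

definition Lp :: "real \<Rightarrow> ('a::euclidean_space \<Rightarrow> real) set" where
  "Lp p = {f \<in> borel_measurable lebesgue. integrable lebesgue (\<lambda>x. \<bar>f x\<bar> powr p)}"

definition frac_variation :: "real \<Rightarrow> ('a::euclidean_space \<Rightarrow> real) \<Rightarrow> ereal" where
  "frac_variation \<alpha> f =
     (SUP \<phi>\<in>{\<phi> \<in> C_infinity_c. AE x in lebesgue. norm (\<phi> x) \<le> 1}.
        ereal (LINT x|lebesgue. f x * frac_div \<alpha> \<phi> x))"

definition BV :: "real \<Rightarrow> real \<Rightarrow> ('a::euclidean_space \<Rightarrow> real) set" where
  "BV \<alpha> p = {f \<in> Lp p. frac_variation \<alpha> f < \<infinity>}"

text \<open>Elements of the Lebesgue spaces are represented by functions, so the sign condition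
  is an almost everywhere one.\<close>

definition BV_plus :: "real \<Rightarrow> real \<Rightarrow> ('a::euclidean_space \<Rightarrow> real) set" where
  "BV_plus \<alpha> p = {f \<in> BV \<alpha> p. AE x in lebesgue. f x \<ge> 0}"

section \<open>Finite vector-valued Radon measures\<close>

text \<open>A vector-valued measure is a countably additive set function on the Borel sets; its values
  on other sets are irrelevant.\<close>

definition total_variation ::
    "('a::topological_space set \<Rightarrow> 'b::real_normed_vector) \<Rightarrow> 'a set \<Rightarrow> ennreal" where
  "total_variation D A =
     (SUP P\<in>{P :: nat \<Rightarrow> 'a set. range P \<subseteq> sets borel \<and> disjoint_family P \<and> (\<Union>i. P i) = A}.
        \<Sum>i. ennreal (norm (D (P i))))"

text \<open>On a Euclidean space every finite Borel measure is Radon, and so is every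
  countably additive set function with values in a Euclidean space.\<close>

definition finite_radon_measure ::
    "('a::euclidean_space set \<Rightarrow> 'b::real_normed_vector) \<Rightarrow> bool" where
  "finite_radon_measure D \<longleftrightarrow>
     (\<forall>A :: nat \<Rightarrow> 'a set. range A \<subseteq> sets borel \<longrightarrow> disjoint_family A \<longrightarrow>
        (\<lambda>i. D (A i)) sums D (\<Union>i. A i)) \<and>
     total_variation D UNIV < \<infinity>"

text \<open>The Jordan decomposition of a real-valued measure into its positive and negative parts
  \<open>(\<bar>m\<bar> + m) / 2\<close> and \<open>(\<bar>m\<bar> - m) / 2\<close>, where \<open>\<bar>m\<bar>\<close> is the total variation measure.\<close>

definition pos_part :: "('a::topological_space set \<Rightarrow> real) \<Rightarrow> 'a measure" where
  "pos_part m =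
     measure_of UNIV (sets borel) (\<lambda>A. ennreal ((enn2real (total_variation m A) + m A) / 2))"

definition neg_part :: "('a::topological_space set \<Rightarrow> real) \<Rightarrow> 'a measure" where
  "neg_part m =
     measure_of UNIV (sets borel) (\<lambda>A. ennreal ((enn2real (total_variation m A) - m A) / 2))"

definition signed_integral ::
    "('a::topological_space set \<Rightarrow> real) \<Rightarrow> ('a \<Rightarrow> real) \<Rightarrow> real" where
  "signed_integral m g = (LINT x|pos_part m. g x) - (LINT x|neg_part m. g x)"

definition vector_integral ::
    "('a::topological_space set \<Rightarrow> 'b::euclidean_space) \<Rightarrow> ('a \<Rightarrow> 'b) \<Rightarrow> real" where
  "vector_integral D \<phi> = (\<Sum>b\<in>Basis. signed_integral (\<lambda>A. D A \<bullet> b) (\<lambda>x. \<phi> x \<bullet> b))"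

text \<open>\<open>D\<close> is the fractional variation measure of \<open>f\<close>. It is determined by this property
  on the Borel sets.\<close>

definition is_frac_variation_measure ::
    "real \<Rightarrow> ('a::euclidean_space \<Rightarrow> real) \<Rightarrow> ('a set \<Rightarrow> 'a) \<Rightarrow> bool" where
  "is_frac_variation_measure \<alpha> f D \<longleftrightarrow>
     finite_radon_measure D \<and>
     (\<forall>\<phi>\<in>Lip_c. (LINT x|lebesgue. f x * frac_div \<alpha> \<phi> x) = - vector_integral D \<phi>)"

section \<open>Half-spaces\<close>

definition half_space :: "'a::real_inner \<Rightarrow> 'a \<Rightarrow> 'a set" where
  "half_space \<nu> x\<^sub>0 = {y. (y - x\<^sub>0) \<bullet> \<nu> > 0}"

end

theory Submission
  imports Defs "HOL-Probability.Distributions"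
begin

text \<open>The distributional fractional divergence of \<open>\<nu> \<chi>\<^sub>H\<close>, where \<open>H = H\<^sub>\<nu>\<^sup>+(x\<^sub>0)\<close>, is
  \<open>\<mu>\<^sub>1\<^sub>,\<^sub>\<alpha> / \<alpha> * \<bar>(x - x\<^sub>0) \<bullet> \<nu>\<bar>\<^bsup>-\<alpha>\<^esup>\<close>, so the inequality is formally the definition of \<open>D\<^sup>\<alpha> f\<close>
  tested against \<open>\<nu> \<chi>\<^sub>H\<close>. To make this rigorous, \<open>\<chi>\<^sub>H\<close> is approximated from inside by
  \<open>g\<^sub>k \<eta>\<^sub>k\<close>, where \<open>g\<^sub>k\<close> is a ramp in the direction \<open>\<nu>\<close> of slope \<open>k\<close> and \<open>\<eta>\<^sub>k\<close> is a cutoff at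
  scale \<open>k\<close>. The divergence of \<open>g\<^sub>k \<eta>\<^sub>k \<nu>\<close> is \<open>\<eta>\<^sub>k\<close> times a nonnegative term, which is handled by
  Fatou's lemma, plus an error bounded by \<open>e\<^sub>k x = \<integral> \<bar>\<eta>\<^sub>k y - \<eta>\<^sub>k x\<bar> \<bar>y - x\<bar>\<^bsup>-n-\<alpha>\<^esup> dy\<close>;
  since \<open>p < n / (n - \<alpha>)\<close>, the integral of \<open>\<bar>f\<bar> e\<^sub>k\<close> tends to \<open>0\<close>.\<close>

section \<open>Kernel integrals over hyperplanes\<close>

text \<open>What remains is Fatou's lemma, once in y and once in x, and it needs signs. They come
  from f \<ge> 0, from \<eta>_k \<ge> 0 and from the monotonicity of the ramp, which makes the
  product of (y - x) . \<nu> and g_k y - g_k x nonnegative; the result is therefore an inequality.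
  Ramp and cutoff are piecewise linear, so their products are Lipschitz with compact support and can
  be tested with directly, without mollification. As g_k vanishes outside the open half-space H, the
  measure side is bounded by |D|(H), and the closure enters through monotonicity only. The constant
  \<mu>_1 / \<alpha> arises because integrating the n-dimensional kernel over the hyperplanes
  orthogonal to \<nu> leaves the one-dimensional kernel times a quotient of Gamma values that turns
  \<mu>_n into \<mu>_1; the remaining integral over a half-line contributes 1 / \<alpha>.\<close>

lemma nn_integral_lborel_shift:
  fixes f :: "'a::euclidean_space \<Rightarrow> ennreal"
  assumes [measurable]: "f \<in> borel_measurable borel"
  shows "(\<integral>\<^sup>+x. f (x + c) \<partial>lborel) = (\<integral>\<^sup>+x. f x \<partial>lborel)"
proof -
  have "(\<integral>\<^sup>+x. f x \<partial>lborel) = (\<integral>\<^sup>+x. f x \<partial>distr lborel borel ((+) c))"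
    by (simp add: lborel_distr_plus)
  also have "\<dots> = (\<integral>\<^sup>+x. f (x + c) \<partial>lborel)"
    by (subst nn_integral_distr) (auto simp: add.commute)
  finally show ?thesis by simp
qed

text \<open>The uniqueness argument for Haar measure, without determinants: the double integral of
  \<open>indicator B x * f (x + T y)\<close> is evaluated in both orders. Translation invariance
  removes x in one order; in the other, invariance of the unit ball \<open>B\<close> under
  \<open>T\<close> removes y. Both sides then carry the volume of \<open>B\<close>, which is
  positive and finite and cancels.\<close>

lemma nn_integral_lborel_orthogonal:
  fixes f :: "'a::euclidean_space \<Rightarrow> ennreal" and T :: "'a \<Rightarrow> 'a"
  assumes T: "orthogonal_transformation T" and [measurable]: "f \<in> borel_measurable borel"
  shows "(\<integral>\<^sup>+x. f (T x) \<partial>lborel) = (\<integral>\<^sup>+x. f x \<partial>lborel)"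
proof -
  have linT: "linear T" using T by (rule orthogonal_transformation_linear)
  have [measurable]: "T \<in> borel_measurable borel"
    using linT by (intro borel_measurable_continuous_onI linear_continuous_on) (simp add: linear_conv_bounded_linear)
  have surjT: "surj T" using T by (rule orthogonal_transformation_surj)
  define B where "B = (ball 0 1 :: 'a set)"
  have [measurable]: "B \<in> sets borel" by (simp add: B_def)
  define c where "c = emeasure lborel B"
  have c: "c \<noteq> 0" "c \<noteq> \<infinity>"
    using unit_ball_vol_pos[of "real DIM('a)"]
    by (simp_all add: c_def B_def emeasure_ball less_imp_neq[symmetric])
  have ind: "(indicator B (x::'a) :: ennreal) = (if norm x < 1 then 1 else 0)" for x
    by (simp add: B_def indicator_def)
  have "c * (\<integral>\<^sup>+y. f (T y) \<partial>lborel) = (\<integral>\<^sup>+x. indicator B x * (\<integral>\<^sup>+y. f (T y) \<partial>lborel) \<partial>lborel)"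
    by (subst nn_integral_multc) (auto simp: c_def)
  also have "\<dots> = (\<integral>\<^sup>+x. indicator B x * (\<integral>\<^sup>+y. f (x + T y) \<partial>lborel) \<partial>lborel)"
  proof (rule nn_integral_cong)
    fix x
    obtain z where z: "T z = x" using surjT by (metis surjD)
    have "(\<integral>\<^sup>+y. f (T (y + z)) \<partial>lborel) = (\<integral>\<^sup>+y. f (T y) \<partial>lborel)"
      by (rule nn_integral_lborel_shift) measurable
    then show "indicator B x * (\<integral>\<^sup>+y. f (T y) \<partial>lborel) = indicator B x * (\<integral>\<^sup>+y. f (x + T y) \<partial>lborel)"
      by (simp add: linear_add[OF linT] z add.commute)
  qed
  also have "\<dots> = (\<integral>\<^sup>+x. (\<integral>\<^sup>+y. indicator B x * f (x + T y) \<partial>lborel) \<partial>lborel)"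
    by (intro nn_integral_cong) (subst nn_integral_cmult, auto)
  also have "\<dots> = (\<integral>\<^sup>+y. (\<integral>\<^sup>+x. indicator B x * f (x + T y) \<partial>lborel) \<partial>lborel)"
    by (rule lborel_pair.Fubini') measurable
  also have "\<dots> = (\<integral>\<^sup>+y. (\<integral>\<^sup>+x. indicator B (x - T y) * f x \<partial>lborel) \<partial>lborel)"
  proof (rule nn_integral_cong)
    fix y
    show "(\<integral>\<^sup>+x. indicator B x * f (x + T y) \<partial>lborel) = (\<integral>\<^sup>+x. indicator B (x - T y) * f x \<partial>lborel)"
      using nn_integral_lborel_shift[of "\<lambda>x. indicator B (x - T y) * f x" "T y"] by simp
  qed
  also have "\<dots> = (\<integral>\<^sup>+x. (\<integral>\<^sup>+y. indicator B (x - T y) * f x \<partial>lborel) \<partial>lborel)"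
    by (rule lborel_pair.Fubini') measurable
  also have "\<dots> = (\<integral>\<^sup>+x. c * f x \<partial>lborel)"
  proof (rule nn_integral_cong)
    fix x
    obtain z where z: "T z = x" using surjT by (metis surjD)
    have *: "norm (x - T y) = norm (y - z)" for y
      using T linear_diff[OF linT, of z y] by (metis z orthogonal_transformation norm_minus_commute)
    have "(\<integral>\<^sup>+y. indicator B (x - T y) * f x \<partial>lborel) = (\<integral>\<^sup>+y. indicator B (y - z) \<partial>lborel) * f x"
      by (subst nn_integral_multc) (auto simp: ind *)
    also have "(\<integral>\<^sup>+y. indicator B (y - z) \<partial>lborel) = (\<integral>\<^sup>+y. indicator B (y :: 'a) \<partial>lborel)"
      using nn_integral_lborel_shift[of "\<lambda>y. indicator B y" "-z"] by simp
    finally show "(\<integral>\<^sup>+y. indicator B (x - T y) * f x \<partial>lborel) = c * f x" by (simp add: c_def)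
  qed
  also have "\<dots> = c * (\<integral>\<^sup>+x. f x \<partial>lborel)"
    by (subst nn_integral_cmult) auto
  finally show ?thesis
    using c ennreal_mult_cancel_left by (metis infinity_ennreal_def)
qed

section \<open>Gaussian and Gamma integrals, and the slicing formula for radial powers\<close>

lemma nn_integral_gaussian:
  assumes "t > 0"
  shows "(\<integral>\<^sup>+s. ennreal (exp (- t * s\<^sup>2)) \<partial>lborel) = ennreal (sqrt (pi / t))"
proof -
  define \<sigma> where "\<sigma> = sqrt (1 / (2 * t))"
  have \<sigma>: "\<sigma> > 0" "\<sigma>\<^sup>2 = 1 / (2 * t)" using assms by (auto simp: \<sigma>_def)
  have eq: "exp (- t * s\<^sup>2) = sqrt (pi / t) * normal_density 0 \<sigma> s" for s
    using assms \<sigma> by (simp add: normal_density_def)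
  have "(\<integral>\<^sup>+s. ennreal (exp (- t * s\<^sup>2)) \<partial>lborel) = ennreal (sqrt (pi / t)) * (\<integral>\<^sup>+s. ennreal (normal_density 0 \<sigma> s) \<partial>lborel)"
    unfolding eq using assms by (subst nn_integral_cmult[symmetric]) (auto simp: ennreal_mult)
  also have "(\<integral>\<^sup>+s. ennreal (normal_density 0 \<sigma> s) \<partial>lborel) = 1"
    using \<sigma> by (subst nn_integral_eq_integral) auto
  finally show ?thesis by simp
qed

text \<open>Euler's integral after the substitution t -> r t. Read from right to left it writes a
  negative power of \<open>r\<close> as a superposition of the exponentials exp (- t r); with a
  squared norm in place of \<open>r\<close> these become Gaussians.\<close>

lemma nn_integral_gamma_scaled:
  assumes "a > 0" "r > 0"
  shows "(\<integral>\<^sup>+t. ennreal (indicator {0<..} t * t powr (a - 1) * exp (- t * r)) \<partial>lborel)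
    = ennreal (Gamma a * r powr (- a))"
proof -
  have "ennreal (Gamma a) = (\<integral>\<^sup>+t. ennreal (indicator {0..} t * t powr (a - 1) / exp t) \<partial>lborel)"
    using assms by (rule_tac Gamma_conv_nn_integral_real)
  also have "\<dots> = ennreal \<bar>r\<bar> * (\<integral>\<^sup>+t. ennreal (indicator {0..} (0 + r * t) * (0 + r * t) powr (a - 1) / exp (0 + r * t)) \<partial>lborel)"
    using assms by (intro nn_integral_real_affine) auto
  also have "\<dots> = ennreal (r powr a) * (\<integral>\<^sup>+t. ennreal (indicator {0<..} t * t powr (a - 1) * exp (- t * r)) \<partial>lborel)"
  proof -
    \<comment> \<open>At \<open>t = 0\<close> the two indicators differ, but
      \<open>0 powr (a - 1)\<close> is 0, so the integrands agree everywhere.\<close>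
    have "ennreal (indicator {0..} (0 + r * t) * (0 + r * t) powr (a - 1) / exp (0 + r * t))
       = ennreal (r powr (a - 1)) * ennreal (indicator {0<..} t * t powr (a - 1) * exp (- t * r))" for t
      using assms by (cases "t = 0") (auto simp: ennreal_mult[symmetric] indicator_def zero_le_mult_iff powr_mult exp_minus field_simps)
    then have "ennreal \<bar>r\<bar> * (\<integral>\<^sup>+t. ennreal (indicator {0..} (0 + r * t) * (0 + r * t) powr (a - 1) / exp (0 + r * t)) \<partial>lborel)
      = ennreal \<bar>r\<bar> * (ennreal (r powr (a - 1)) * (\<integral>\<^sup>+t. ennreal (indicator {0<..} t * t powr (a - 1) * exp (- t * r)) \<partial>lborel))"
      by (simp add: nn_integral_cmult)
    moreover have "ennreal \<bar>r\<bar> * ennreal (r powr (a - 1)) = ennreal (r powr a)"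
      using assms by (simp add: ennreal_mult[symmetric] powr_diff)
    ultimately show ?thesis by (simp add: mult.assoc[symmetric])
  qed
  finally have *: "ennreal (Gamma a) = ennreal (r powr a) * (\<integral>\<^sup>+t. ennreal (indicator {0<..} t * t powr (a - 1) * exp (- t * r)) \<partial>lborel)" .
  have "ennreal (Gamma a * r powr (- a)) = ennreal (r powr (-a)) * ennreal (Gamma a)"
    using assms by (subst mult.commute) (simp add: ennreal_mult Gamma_real_nonneg)
  also have "\<dots> = (ennreal (r powr (-a)) * ennreal (r powr a)) * (\<integral>\<^sup>+t. ennreal (indicator {0<..} t * t powr (a - 1) * exp (- t * r)) \<partial>lborel)"
    unfolding * by (simp add: mult.assoc)
  also have "ennreal (r powr (-a)) * ennreal (r powr a) = 1"
    using assms by (simp add: ennreal_mult[symmetric] powr_add[symmetric])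
  finally show ?thesis by simp
qed

text \<open>A Gaussian is radial and at the same time a product over coordinates. Radiality allows
  \<nu> to be rotated onto a basis vector; the product structure then lets each of the n - 1 other
  coordinates contribute a factor \<open>sqrt (pi / t)\<close>.\<close>

lemma nn_integral_gaussian_slice:
  fixes \<nu> :: "real ^ 'n" and h :: "real \<Rightarrow> real"
  assumes [measurable]: "h \<in> borel_measurable borel" and h: "\<And>s. h s \<ge> 0"
    and \<nu>: "norm \<nu> = 1" and t: "t > 0"
  shows "(\<integral>\<^sup>+w. ennreal (h (w \<bullet> \<nu>) * exp (- t * (norm w)\<^sup>2)) \<partial>lborel)
    = ennreal ((pi / t) powr ((real CARD('n) - 1) / 2)) * (\<integral>\<^sup>+s. ennreal (h s * exp (- t * s\<^sup>2)) \<partial>lborel)"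
proof -
  obtain b0 :: "real ^ 'n" where b0: "b0 \<in> Basis" using nonempty_Basis by blast
  obtain T :: "real ^ 'n \<Rightarrow> real ^ 'n" where T: "orthogonal_transformation T" "T b0 = \<nu>"
    using orthogonal_transformation_exists_1[of b0 \<nu>] b0 \<nu> by auto
  have [simp]: "T w \<bullet> \<nu> = w \<bullet> b0" "norm (T w) = norm w" for w
    using T by (auto simp: orthogonal_transformation_def orthogonal_transformation_norm simp flip: T(2))
  define F where "F = (\<lambda>(b::real^'n) s. (if b = b0 then h s else 1) * exp (- t * s\<^sup>2))"
  have [measurable]: "F b \<in> borel_measurable borel" for b unfolding F_def by (cases "b = b0") auto
  have "(\<integral>\<^sup>+w. ennreal (h (w \<bullet> \<nu>) * exp (- t * (norm w)\<^sup>2)) \<partial>lborel)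
      = (\<integral>\<^sup>+w. ennreal (h (T w \<bullet> \<nu>) * exp (- t * (norm (T w))\<^sup>2)) \<partial>lborel)"
    by (rule nn_integral_lborel_orthogonal[OF T(1), symmetric]) measurable
  also have "\<dots> = (\<integral>\<^sup>+w. ennreal (\<Prod>b\<in>Basis. F b (w \<bullet> b)) \<partial>lborel)"
  proof (intro nn_integral_cong arg_cong[where f=ennreal])
    fix w :: "real^'n"
    have "(norm w)\<^sup>2 = (\<Sum>b\<in>Basis. (w \<bullet> b)\<^sup>2)"
      unfolding power2_norm_eq_inner by (subst euclidean_inner) (simp add: power2_eq_square)
    then have "exp (- t * (norm w)\<^sup>2) = (\<Prod>b\<in>Basis. exp (- t * (w \<bullet> b)\<^sup>2))"
      by (simp add: exp_sum[symmetric] sum_distrib_left sum_negf)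
    then show "h (T w \<bullet> \<nu>) * exp (- t * (norm (T w))\<^sup>2) = (\<Prod>b\<in>Basis. F b (w \<bullet> b))"
      using b0 by (simp add: F_def prod.distrib prod.delta)
  qed
  also have "\<dots> = (\<Prod>b\<in>Basis. (\<integral>\<^sup>+s. F b s \<partial>lborel))"
    using h by (subst nn_integral_lborel_prod[symmetric]) (auto simp: prod_ennreal F_def)
  also have "\<dots> = (\<integral>\<^sup>+s. F b0 s \<partial>lborel) * (\<Prod>b\<in>Basis - {b0}. (\<integral>\<^sup>+s. F b s \<partial>lborel))"
    using b0 by (simp add: prod.remove)
  also have "(\<Prod>b\<in>Basis - {b0}. (\<integral>\<^sup>+s. F b s \<partial>lborel)) = (\<Prod>b\<in>Basis - {b0}. ennreal (sqrt (pi / t)))"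
    using nn_integral_gaussian[OF t] by (intro prod.cong) (auto simp: F_def)
  also have "\<dots> = ennreal ((sqrt (pi / t)) ^ (CARD('n) - 1))"
    using b0 t by (simp add: ennreal_power)
  also have "(sqrt (pi / t)) ^ (CARD('n) - 1) = (pi / t) powr ((real CARD('n) - 1) / 2)"
  proof -
    have "CARD('n) \<ge> 1" by (simp add: Suc_leI)
    then show ?thesis
      using t by (simp add: powr_half_sqrt[symmetric] powr_realpow[symmetric] powr_powr of_nat_diff)
  qed
  finally show ?thesis by (simp add: F_def mult.commute)
qed

text \<open>Writing \<open>\<bar>w\<bar>\<^sup>-\<^sup>2\<^sup>a\<close> as a superposition of Gaussians makes the integral over the
  hyperplanes orthogonal to \<open>\<nu>\<close> explicit.\<close>

lemma nn_integral_powr_slice: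
  fixes \<nu> :: "real ^ 'n" and h :: "real \<Rightarrow> real"
  assumes [measurable]: "h \<in> borel_measurable borel" and h: "\<And>s. h s \<ge> 0"
    and \<nu>: "norm \<nu> = 1" and a: "2 * a > real CARD('n) - 1"
  shows "(\<integral>\<^sup>+w. ennreal (h (w \<bullet> \<nu>) * norm w powr (- 2 * a)) \<partial>lborel)
    = ennreal (pi powr ((real CARD('n) - 1) / 2) * Gamma (a - (real CARD('n) - 1) / 2) / Gamma a)
      * (\<integral>\<^sup>+s. ennreal (h s * \<bar>s\<bar> powr (real CARD('n) - 1 - 2 * a)) \<partial>lborel)"
proof -
  define m where "m = (real CARD('n) - 1) / 2"
  have m: "m \<ge> 0" by (simp add: m_def Suc_leI)
  have a0: "a - m > 0" using a by (simp add: m_def field_simps)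
  with m have a0: "a > 0" "a - m > 0" by auto
  have G: "Gamma a > 0" using a0 by (simp add: Gamma_real_pos)
  have gam: "ennreal (h s * r powr (- 2 * b) * Gamma b)
      = (\<integral>\<^sup>+t. ennreal (indicator {0<..} t * t powr (b - 1) * (h s * exp (- t * r\<^sup>2))) \<partial>lborel)"
    if "b > 0" "r > 0" for s r b
  proof -
    have "r powr (- 2 * b) = (r\<^sup>2) powr (- b)"
      using that by (simp add: powr_powr flip: powr_numeral)
    then have "ennreal (h s * r powr (- 2 * b) * Gamma b) = ennreal (h s) * ennreal (Gamma b * (r\<^sup>2) powr (- b))"
      using h by (simp add: ennreal_mult'[symmetric] mult_ac)
    also have "\<dots> = ennreal (h s) * (\<integral>\<^sup>+t. ennreal (indicator {0<..} t * t powr (b - 1) * exp (- t * r\<^sup>2)) \<partial>lborel)"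
      using nn_integral_gamma_scaled[of b "r\<^sup>2"] that by simp
    also have "\<dots> = (\<integral>\<^sup>+t. ennreal (indicator {0<..} t * t powr (b - 1) * (h s * exp (- t * r\<^sup>2))) \<partial>lborel)"
      using h by (subst nn_integral_cmult[symmetric]) (auto simp: ennreal_mult'[symmetric] mult_ac)
    finally show ?thesis .
  qed
  have "ennreal (Gamma a) * (\<integral>\<^sup>+w. ennreal (h (w \<bullet> \<nu>) * norm w powr (- 2 * a)) \<partial>lborel)
     = (\<integral>\<^sup>+w. ennreal (h (w \<bullet> \<nu>) * norm w powr (- 2 * a) * Gamma a) \<partial>lborel)"
    using G h by (subst nn_integral_cmult[symmetric]) (auto simp: ennreal_mult[symmetric] mult_ac)
  \<comment> \<open>\<open>gam\<close> needs a positive radius; the origin, where it fails, is a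
    null set.\<close>
  also have "\<dots> = (\<integral>\<^sup>+w. (\<integral>\<^sup>+t. ennreal (indicator {0<..} t * t powr (a - 1) * (h (w \<bullet> \<nu>) * exp (- t * (norm w)\<^sup>2))) \<partial>lborel) \<partial>lborel)"
    using a0 by (intro nn_integral_cong_AE eventually_mono[OF AE_lborel_singleton[of 0]] gam) auto
  also have "\<dots> = (\<integral>\<^sup>+t. (\<integral>\<^sup>+w. ennreal (indicator {0<..} t * t powr (a - 1) * (h (w \<bullet> \<nu>) * exp (- t * (norm w)\<^sup>2))) \<partial>lborel) \<partial>lborel)"
    by (rule lborel_pair.Fubini') measurable
  \<comment> \<open>Integrating out the n - 1 = 2 m orthogonal directions produces
    \<open>(pi / t) powr m\<close>, which lowers the exponent of t by m. The integral over t is then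
    again of the form \<open>gam\<close>, with \<open>a - m\<close> in place of \<open>a\<close>;
    the hypothesis on \<open>a\<close> is exactly \<open>a - m > 0\<close>.\<close>
  also have "\<dots> = (\<integral>\<^sup>+t. (\<integral>\<^sup>+s. ennreal (pi powr m) * ennreal (indicator {0<..} t * t powr (a - m - 1) * (h s * exp (- t * s\<^sup>2))) \<partial>lborel) \<partial>lborel)"
  proof (rule nn_integral_cong)
    fix t :: real
    show "(\<integral>\<^sup>+w. ennreal (indicator {0<..} t * t powr (a - 1) * (h (w \<bullet> \<nu>) * exp (- t * (norm w)\<^sup>2))) \<partial>lborel)
      = (\<integral>\<^sup>+s. ennreal (pi powr m) * ennreal (indicator {0<..} t * t powr (a - m - 1) * (h s * exp (- t * s\<^sup>2))) \<partial>lborel)"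
    proof (cases "t > 0")
      case True
      have "(\<integral>\<^sup>+w. ennreal (indicator {0<..} t * t powr (a - 1) * (h (w \<bullet> \<nu>) * exp (- t * (norm w)\<^sup>2))) \<partial>lborel)
        = ennreal (t powr (a - 1)) * (\<integral>\<^sup>+w. ennreal (h (w \<bullet> \<nu>) * exp (- t * (norm w)\<^sup>2)) \<partial>lborel)"
        using True h by (subst nn_integral_cmult[symmetric]) (auto simp: ennreal_mult'[symmetric])
      also have "\<dots> = ennreal (t powr (a - 1)) * (ennreal ((pi / t) powr m) * (\<integral>\<^sup>+s. ennreal (h s * exp (- t * s\<^sup>2)) \<partial>lborel))"
        using nn_integral_gaussian_slice[OF assms(1) h \<nu> True] by (simp add: m_def)
      also have "\<dots> = (\<integral>\<^sup>+s. ennreal (t powr (a - 1)) * (ennreal ((pi / t) powr m) * ennreal (h s * exp (- t * s\<^sup>2))) \<partial>lborel)"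
        by (simp add: nn_integral_cmult)
      also have "\<dots> = (\<integral>\<^sup>+s. ennreal (pi powr m) * ennreal (indicator {0<..} t * t powr (a - m - 1) * (h s * exp (- t * s\<^sup>2))) \<partial>lborel)"
        using True h by (intro nn_integral_cong)
          (auto simp: ennreal_mult[symmetric] powr_divide powr_diff divide_simps mult_ac)
      finally show ?thesis .
    qed simp
  qed
  also have "\<dots> = (\<integral>\<^sup>+s. (\<integral>\<^sup>+t. ennreal (pi powr m) * ennreal (indicator {0<..} t * t powr (a - m - 1) * (h s * exp (- t * s\<^sup>2))) \<partial>lborel) \<partial>lborel)"
    by (rule lborel_pair.Fubini') measurable
  also have "\<dots> = (\<integral>\<^sup>+s. ennreal (pi powr m) * ennreal (h s * \<bar>s\<bar> powr (- 2 * (a - m)) * Gamma (a - m)) \<partial>lborel)"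
  proof (intro nn_integral_cong_AE eventually_mono[OF AE_lborel_singleton[of 0]])
    fix s :: real assume "s \<noteq> 0"
    then show "(\<integral>\<^sup>+t. ennreal (pi powr m) * ennreal (indicator {0<..} t * t powr (a - m - 1) * (h s * exp (- t * s\<^sup>2))) \<partial>lborel)
      = ennreal (pi powr m) * ennreal (h s * \<bar>s\<bar> powr (- 2 * (a - m)) * Gamma (a - m))"
      using gam[of "a - m" "\<bar>s\<bar>" s] a0 by (subst nn_integral_cmult) auto
  qed
  also have "\<dots> = (\<integral>\<^sup>+s. ennreal (pi powr m * Gamma (a - m)) * ennreal (h s * \<bar>s\<bar> powr (- 2 * (a - m))) \<partial>lborel)"
    using h a0 by (intro nn_integral_cong) (auto simp: ennreal_mult'[symmetric] mult_ac Gamma_real_pos less_imp_le)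
  also have "\<dots> = ennreal (pi powr m * Gamma (a - m)) * (\<integral>\<^sup>+s. ennreal (h s * \<bar>s\<bar> powr (- 2 * (a - m))) \<partial>lborel)"
    by (simp add: nn_integral_cmult)
  finally have *: "ennreal (Gamma a) * (\<integral>\<^sup>+w. ennreal (h (w \<bullet> \<nu>) * norm w powr (- 2 * a)) \<partial>lborel)
    = ennreal (pi powr m * Gamma (a - m)) * (\<integral>\<^sup>+s. ennreal (h s * \<bar>s\<bar> powr (- 2 * (a - m))) \<partial>lborel)" .
  have "(\<integral>\<^sup>+w. ennreal (h (w \<bullet> \<nu>) * norm w powr (- 2 * a)) \<partial>lborel)
     = ennreal (1 / Gamma a) * (ennreal (Gamma a) * (\<integral>\<^sup>+w. ennreal (h (w \<bullet> \<nu>) * norm w powr (- 2 * a)) \<partial>lborel))"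
    using G by (simp add: mult.assoc[symmetric] ennreal_mult[symmetric])
  also have "\<dots> = ennreal (pi powr m * Gamma (a - m) / Gamma a) * (\<integral>\<^sup>+s. ennreal (h s * \<bar>s\<bar> powr (- 2 * (a - m))) \<partial>lborel)"
    using G a0 unfolding * by (simp add: mult.assoc[symmetric] ennreal_mult[symmetric] Gamma_real_pos less_imp_le)
  also have "- 2 * (a - m) = real CARD('n) - 1 - 2 * a" by (simp add: m_def field_simps)
  finally show ?thesis by (simp add: m_def)
qed

section \<open>Power kernels on the line and the truncated kernel in n dimensions\<close>

lemma nn_integral_powr_Ici:
  assumes "\<alpha> > 0" "r > 0"
  shows "(\<integral>\<^sup>+s. ennreal (s powr (- 1 - \<alpha>)) * indicator {r..} s \<partial>lborel) = ennreal (r powr (- \<alpha>) / \<alpha>)"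
  using nn_integral_has_integral_lebesgue'[OF _ has_integral_powr_to_inf[of "- 1 - \<alpha>" r]] assms by simp

lemma nn_integral_powr_Icc:
  assumes "\<alpha> < 1" "r > 0"
  shows "(\<integral>\<^sup>+s. ennreal (s powr (- \<alpha>)) * indicator {0..r} s \<partial>lborel) = ennreal (r powr (1 - \<alpha>) / (1 - \<alpha>))"
  using nn_integral_has_integral_lebesgue'[OF _ has_integral_powr_from_0[of "- \<alpha>" r]] assms
  by (simp add: add.commute)

lemma nn_integral_lborel_reflect:
  fixes g :: "real \<Rightarrow> ennreal"
  assumes "g \<in> borel_measurable borel"
  shows "(\<integral>\<^sup>+s. g (- s) \<partial>lborel) = (\<integral>\<^sup>+s. g s \<partial>lborel)"
  using nn_integral_real_affine[OF assms, of "-1" 0] by simp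

text \<open>The truncation switches at |s| = r. Below it the factor |s| / r improves the kernel to
  |s|^(-\<alpha>), integrable at 0 because \<alpha> < 1; above it |s|^(-1-\<alpha>) is integrable at
  infinity because \<alpha> > 0. The constant is 1/(1-\<alpha>) + 1/\<alpha> =
  1/(\<alpha>(1-\<alpha>)), doubled for the two half-lines.\<close>

lemma nn_integral_truncated_powr_le:
  assumes \<alpha>: "0 < \<alpha>" "\<alpha> < 1" and r: "r > 0"
  shows "(\<integral>\<^sup>+s. ennreal (min 1 (\<bar>s\<bar> / r) * \<bar>s\<bar> powr (- 1 - \<alpha>)) \<partial>lborel)
    \<le> ennreal (2 / (\<alpha> * (1 - \<alpha>)) * r powr (- \<alpha>))"
proof -
  define g where "g s = ennreal (1 / r) * (ennreal (s powr (- \<alpha>)) * indicator {0..r} s)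
    + ennreal (s powr (- 1 - \<alpha>)) * indicator {r..} s" for s
  have [measurable]: "g \<in> borel_measurable borel" unfolding g_def by measurable
  have pos: "ennreal (min 1 (s / r) * s powr (- 1 - \<alpha>)) \<le> g s" if "s \<ge> 0" for s
  proof (cases "s \<le> r")
    case True
    \<comment> \<open>For \<open>s = 0\<close> both sides are 0 because \<open>0 powr\<close>
      anything is 0.\<close>
    have "s * s powr (- 1 - \<alpha>) = s powr (- \<alpha>)"
      using that by (cases "s = 0") (simp_all add: powr_mult_base)
    moreover have "min 1 (s / r) = s / r" using True r by simp
    ultimately have "min 1 (s / r) * s powr (- 1 - \<alpha>) = 1 / r * s powr (- \<alpha>)"
      by (simp add: field_simps)
    then have "ennreal (min 1 (s / r) * s powr (- 1 - \<alpha>)) = ennreal (1 / r) * ennreal (s powr (- \<alpha>))"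
      using r by (simp add: ennreal_mult[symmetric])
    also have "\<dots> \<le> g s" using that True by (simp add: g_def)
    finally show ?thesis .
  next
    case False
    then show ?thesis using r that by (auto simp: g_def min_def)
  qed
  have "ennreal (min 1 (\<bar>s\<bar> / r) * \<bar>s\<bar> powr (- 1 - \<alpha>)) \<le> g s + g (- s)" for s
    using pos[of s] pos[of "- s"] by (cases "s \<ge> 0") (auto intro: add_increasing add_increasing2)
  then have "(\<integral>\<^sup>+s. ennreal (min 1 (\<bar>s\<bar> / r) * \<bar>s\<bar> powr (- 1 - \<alpha>)) \<partial>lborel)
      \<le> (\<integral>\<^sup>+s. g s + g (- s) \<partial>lborel)" by (intro nn_integral_mono)
  also have "\<dots> = (\<integral>\<^sup>+s. g s \<partial>lborel) + (\<integral>\<^sup>+s. g s \<partial>lborel)"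
    by (subst nn_integral_add) (auto simp: nn_integral_lborel_reflect)
  also have "(\<integral>\<^sup>+s. g s \<partial>lborel) = ennreal (1 / r) * ennreal (r powr (1 - \<alpha>) / (1 - \<alpha>)) + ennreal (r powr (- \<alpha>) / \<alpha>)"
    unfolding g_def using \<alpha> r
    by (subst nn_integral_add, measurable, subst nn_integral_cmult, measurable)
      (simp only: nn_integral_powr_Icc nn_integral_powr_Ici)
  also have "\<dots> = ennreal (1 / (\<alpha> * (1 - \<alpha>)) * r powr (- \<alpha>))"
  proof -
    have "1 / r * (r powr (1 - \<alpha>) / (1 - \<alpha>)) = r powr (- \<alpha>) / (1 - \<alpha>)"
      using r by (simp add: powr_diff powr_minus divide_inverse)
    then have "ennreal (1 / r) * ennreal (r powr (1 - \<alpha>) / (1 - \<alpha>)) = ennreal (r powr (- \<alpha>) / (1 - \<alpha>))"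
      using \<alpha> r by (simp add: ennreal_mult[symmetric])
    moreover have "r powr (- \<alpha>) / (1 - \<alpha>) + r powr (- \<alpha>) / \<alpha> = 1 / (\<alpha> * (1 - \<alpha>)) * r powr (- \<alpha>)"
      using \<alpha> by (simp add: add_frac_eq algebra_simps)
    ultimately show ?thesis using \<alpha>
      by (simp add: ennreal_plus[symmetric] del: ennreal_plus)
  qed
  also have "\<dots> + \<dots> = ennreal (2 / (\<alpha> * (1 - \<alpha>)) * r powr (- \<alpha>))"
    using \<alpha> by (subst ennreal_plus[symmetric]) (auto simp: mult.assoc)
  finally show ?thesis .
qed

text \<open>Replaces a radial truncation by truncations in a single coordinate, the form to which
  the slicing formula applies. If some coordinate is saturated, its term alone is 1; otherwise no
  minimum is active and the bound is that of the Euclidean norm by the l^1 norm.\<close>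

lemma min_one_norm_le:
  fixes w :: "'a::euclidean_space"
  assumes "r > 0"
  shows "min 1 (norm w / r) \<le> (\<Sum>b\<in>Basis. min 1 (\<bar>w \<bullet> b\<bar> / r))"
proof (cases "\<exists>b\<in>Basis. \<bar>w \<bullet> b\<bar> / r \<ge> 1")
  case True
  then obtain b :: 'a where b: "b \<in> Basis" "\<bar>w \<bullet> b\<bar> / r \<ge> 1" by blast
  have "min 1 (\<bar>w \<bullet> b\<bar> / r) \<le> (\<Sum>b\<in>Basis. min 1 (\<bar>w \<bullet> b\<bar> / r))"
    using b assms by (intro member_le_sum) auto
  then show ?thesis using b by simp
next
  case False
  then have "(\<Sum>b\<in>Basis. min 1 (\<bar>w \<bullet> b\<bar> / r)) = (\<Sum>b\<in>Basis. \<bar>w \<bullet> b\<bar>) / r"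
    unfolding sum_divide_distrib by (intro sum.cong) auto
  moreover have "norm w / r \<le> (\<Sum>b\<in>Basis. \<bar>w \<bullet> b\<bar>) / r"
    using norm_le_l1[of w] assms by (intro divide_right_mono) auto
  ultimately show ?thesis by simp
qed

text \<open>The rate r^(-\<alpha>) is dictated by the scaling w -> r w. Each of the n coordinate
  truncations from \<open>min_one_norm_le\<close> is sliced along its own axis and reduced to the
  one-dimensional bound, hence the factor n in \<open>C\<close>; polar coordinates do not
  enter.\<close>

lemma nn_integral_truncated_kernel_le:
  assumes \<alpha>: "0 < \<alpha>" "\<alpha> < 1"
  obtains C where "C > 0" and "\<And>r. r > 0 \<Longrightarrow>
    (\<integral>\<^sup>+w. ennreal (min 1 (norm (w :: real ^ 'n) / r) * norm w powr (- (real CARD('n) + \<alpha>))) \<partial>lborel)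
      \<le> ennreal (C * r powr (- \<alpha>))"
proof -
  \<comment> \<open>With this choice the kernel is \<open>norm w powr (- 2 * a)\<close>, and slicing
    leaves the exponent -1 - \<alpha> on the line.\<close>
  define a where "a = (real CARD('n) + \<alpha>) / 2"
  define c where "c = pi powr ((real CARD('n) - 1) / 2) * Gamma (a - (real CARD('n) - 1) / 2) / Gamma a"
  have a: "a > 0" "a - (real CARD('n) - 1) / 2 > 0" "2 * a > real CARD('n) - 1"
    using \<alpha> by (simp_all add: a_def field_simps)
  then have c: "c > 0" by (simp add: c_def)
  have e0: "- (real CARD('n) + \<alpha>) = - 2 * a" by (simp add: a_def)
  define C where "C = real CARD('n) * (c * (2 / (\<alpha> * (1 - \<alpha>))))"
  have C0: "C > 0" using c \<alpha> unfolding C_def by (intro mult_pos_pos divide_pos_pos) auto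
  have "(\<integral>\<^sup>+w. ennreal (min 1 (norm (w :: real ^ 'n) / r) * norm w powr (- (real CARD('n) + \<alpha>))) \<partial>lborel)
      \<le> ennreal (C * r powr (- \<alpha>))" if r: "r > 0" for r
  proof -
    have "(\<integral>\<^sup>+w. ennreal (min 1 (norm (w :: real ^ 'n) / r) * norm w powr (- (real CARD('n) + \<alpha>))) \<partial>lborel)
      \<le> (\<integral>\<^sup>+w. (\<Sum>b\<in>(Basis :: (real ^ 'n) set). ennreal (min 1 (\<bar>w \<bullet> b\<bar> / r) * norm w powr (- 2 * a))) \<partial>lborel)"
    proof (rule nn_integral_mono)
      fix w :: "real^'n"
      have "min 1 (norm w / r) * norm w powr (- (real CARD('n) + \<alpha>))
        \<le> (\<Sum>b\<in>Basis. min 1 (\<bar>w \<bullet> b\<bar> / r)) * norm w powr (- 2 * a)"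
        unfolding e0 using min_one_norm_le[OF r, of w] by (rule mult_right_mono) simp
      then show "ennreal (min 1 (norm w / r) * norm w powr (- (real CARD('n) + \<alpha>)))
        \<le> (\<Sum>b\<in>Basis. ennreal (min 1 (\<bar>w \<bullet> b\<bar> / r) * norm w powr (- 2 * a)))"
        using r by (subst sum_ennreal) (auto simp: sum_distrib_right intro: ennreal_leI)
    qed
    also have "\<dots> = (\<Sum>b\<in>(Basis :: (real ^ 'n) set). \<integral>\<^sup>+w. ennreal (min 1 (\<bar>w \<bullet> (b :: real ^ 'n)\<bar> / r) * norm w powr (- 2 * a)) \<partial>lborel)"
      by (rule nn_integral_sum) measurable
    also have "\<dots> \<le> (\<Sum>b\<in>(Basis :: (real^'n) set). ennreal (c * (2 / (\<alpha> * (1 - \<alpha>)) * r powr (- \<alpha>))))"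
    proof (rule sum_mono)
      fix b :: "real^'n" assume b: "b \<in> Basis"
      have e: "real CARD('n) - 1 - 2 * a = - 1 - \<alpha>" by (simp add: a_def field_simps)
      have "(\<integral>\<^sup>+w. ennreal (min 1 (\<bar>w \<bullet> (b :: real ^ 'n)\<bar> / r) * norm w powr (- 2 * a)) \<partial>lborel)
        = ennreal c * (\<integral>\<^sup>+s. ennreal (min 1 (\<bar>s\<bar> / r) * \<bar>s\<bar> powr (- 1 - \<alpha>)) \<partial>lborel)"
        using nn_integral_powr_slice[of "\<lambda>s. min 1 (\<bar>s\<bar> / r)" b a] b a r by (simp add: c_def e)
      also have "\<dots> \<le> ennreal c * ennreal (2 / (\<alpha> * (1 - \<alpha>)) * r powr (- \<alpha>))"
        using nn_integral_truncated_powr_le[OF \<alpha> r] by (rule mult_left_mono) simp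
      also have "\<dots> = ennreal (c * (2 / (\<alpha> * (1 - \<alpha>)) * r powr (- \<alpha>)))"
        using c \<alpha> by (intro ennreal_mult[symmetric]) auto
      finally show "(\<integral>\<^sup>+w. ennreal (min 1 (\<bar>w \<bullet> (b :: real ^ 'n)\<bar> / r) * norm w powr (- 2 * a)) \<partial>lborel)
        \<le> ennreal (c * (2 / (\<alpha> * (1 - \<alpha>)) * r powr (- \<alpha>)))" .
    qed
    also have "\<dots> = ennreal (C * r powr (- \<alpha>))"
      using c \<alpha> unfolding sum_constant ennreal_of_nat_eq_real_of_nat
      by (subst ennreal_mult[symmetric]) (auto simp: C_def mult.assoc)
    finally show ?thesis .
  qed
  then show thesis by (rule that[OF C0])
qed

section \<open>The nonlocal gradient\<close>

text \<open>For u = \<eta>_k this is the error e_k of the overview; its integral over x is the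
  Gagliardo seminorm of the fractional Sobolev space W^{\<alpha>,1}. Being valued in
  \<open>ennreal\<close>, it makes sense before any finiteness is known.\<close>

definition nonlocal_gradient :: "real \<Rightarrow> (real ^ 'n \<Rightarrow> real) \<Rightarrow> real ^ 'n \<Rightarrow> ennreal" where
  "nonlocal_gradient \<alpha> u x =
     (\<integral>\<^sup>+y. ennreal (\<bar>u y - u x\<bar> * norm (y - x) powr (- (real CARD('n) + \<alpha>))) \<partial>lborel)"

lemma borel_measurable_nonlocal_gradient[measurable]:
  assumes [measurable]: "u \<in> borel_measurable borel"
  shows "nonlocal_gradient \<alpha> u \<in> borel_measurable borel"
  unfolding nonlocal_gradient_def[abs_def] by measurable

text \<open>A supremum bound and an L^1 bound with one constant that is uniform in u, r and S;
  together they control every pairing with an L^p function. After the substitution y = x + w, the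
  first is the truncated kernel integral. For the second, the integrand vanishes unless x or x + w
  lies in S, and for fixed w each of these two conditions describes a set of measure |S|, hence the
  factor 2.\<close>

lemma nonlocal_gradient_bounds:
  assumes \<alpha>: "0 < \<alpha>" "\<alpha> < 1"
  obtains C where "C > 0"
    and "\<And>(u :: real^'n \<Rightarrow> real) r x. r > 0 \<Longrightarrow> u \<in> borel_measurable borel \<Longrightarrow>
      (\<And>x y. \<bar>u y - u x\<bar> \<le> min 1 (norm (y - x) / r)) \<Longrightarrow>
      nonlocal_gradient \<alpha> u x \<le> ennreal (C * r powr (- \<alpha>))"
    and "\<And>(u :: real^'n \<Rightarrow> real) r S. r > 0 \<Longrightarrow> u \<in> borel_measurable borel \<Longrightarrow> S \<in> sets borel \<Longrightarrow>
      (\<And>x y. \<bar>u y - u x\<bar> \<le> min 1 (norm (y - x) / r)) \<Longrightarrow> (\<And>x. x \<notin> S \<Longrightarrow> u x = 0) \<Longrightarrow>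
      (\<integral>\<^sup>+x. nonlocal_gradient \<alpha> u x \<partial>lborel) \<le> 2 * emeasure lborel S * ennreal (C * r powr (- \<alpha>))"
proof -
  let ?s = "- (real CARD('n) + \<alpha>)"
  obtain C where C: "C > 0" "\<And>r. r > 0 \<Longrightarrow>
    (\<integral>\<^sup>+w. ennreal (min 1 (norm (w :: real ^ 'n) / r) * norm w powr ?s) \<partial>lborel) \<le> ennreal (C * r powr (- \<alpha>))"
    using nn_integral_truncated_kernel_le[OF \<alpha>, where 'n = 'n] by blast
  have shift: "nonlocal_gradient \<alpha> u x = (\<integral>\<^sup>+w. ennreal (\<bar>u (w + x) - u x\<bar> * norm w powr ?s) \<partial>lborel)"
    if [measurable]: "u \<in> borel_measurable borel" for u :: "real^'n \<Rightarrow> real" and x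
    using nn_integral_lborel_shift[of "\<lambda>y. ennreal (\<bar>u y - u x\<bar> * norm (y - x) powr ?s)" x]
    by (simp add: nonlocal_gradient_def)
  have 1: "nonlocal_gradient \<alpha> u x \<le> ennreal (C * r powr (- \<alpha>))"
    if r: "r > 0" and [measurable]: "u \<in> borel_measurable borel"
      and u: "\<And>x y. \<bar>u y - u x\<bar> \<le> min 1 (norm (y - x) / r)"
    for u :: "real^'n \<Rightarrow> real" and r x
  proof -
    have "nonlocal_gradient \<alpha> u x \<le> (\<integral>\<^sup>+w. ennreal (min 1 (norm (w :: real ^ 'n) / r) * norm w powr ?s) \<partial>lborel)"
      unfolding shift[OF \<open>u \<in> _\<close>]
    proof (rule nn_integral_mono)
      fix w
      show "ennreal (\<bar>u (w + x) - u x\<bar> * norm w powr ?s) \<le> ennreal (min 1 (norm w / r) * norm w powr ?s)"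
        using u[of "w + x" x] by (intro ennreal_leI mult_right_mono) auto
    qed
    then show ?thesis using C(2)[OF r] by (rule order_trans)
  qed
  have 2: "(\<integral>\<^sup>+x. nonlocal_gradient \<alpha> u x \<partial>lborel) \<le> 2 * emeasure lborel S * ennreal (C * r powr (- \<alpha>))"
    if r: "r > 0" and [measurable]: "u \<in> borel_measurable borel" "S \<in> sets borel"
      and u: "\<And>x y. \<bar>u y - u x\<bar> \<le> min 1 (norm (y - x) / r)" and S: "\<And>x. x \<notin> S \<Longrightarrow> u x = 0"
    for u :: "real^'n \<Rightarrow> real" and r S
  proof -
    have "(\<integral>\<^sup>+x. nonlocal_gradient \<alpha> u x \<partial>lborel)
       = (\<integral>\<^sup>+x. (\<integral>\<^sup>+w. ennreal (\<bar>u (w + x) - u x\<bar> * norm w powr ?s) \<partial>lborel) \<partial>lborel)"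
      by (simp add: shift)
    also have "\<dots> = (\<integral>\<^sup>+w. (\<integral>\<^sup>+x. ennreal (\<bar>u (w + x) - u x\<bar> * norm w powr ?s) \<partial>lborel) \<partial>lborel)"
      by (rule lborel_pair.Fubini') measurable
    also have "\<dots> \<le> (\<integral>\<^sup>+w. ennreal (min 1 (norm (w :: real ^ 'n) / r) * norm w powr ?s) * (2 * emeasure lborel S) \<partial>lborel)"
    proof (rule nn_integral_mono)
      fix w :: "real^'n"
      have "(\<integral>\<^sup>+x. ennreal (\<bar>u (w + x) - u x\<bar> * norm w powr ?s) \<partial>lborel)
         \<le> (\<integral>\<^sup>+x. ennreal (min 1 (norm w / r) * norm w powr ?s) * (indicator S (x + w) + indicator S x) \<partial>lborel)"
      proof (rule nn_integral_mono)
        fix x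
        have 1: "ennreal (\<bar>u (w + x) - u x\<bar> * norm w powr ?s) \<le> ennreal (min 1 (norm w / r) * norm w powr ?s)"
          using u[of "w + x" x] by (intro ennreal_leI mult_right_mono) auto
        show "ennreal (\<bar>u (w + x) - u x\<bar> * norm w powr ?s)
           \<le> ennreal (min 1 (norm w / r) * norm w powr ?s) * (indicator S (x + w) + indicator S x)"
        proof (cases "x \<in> S \<or> x + w \<in> S")
          case True
          then have "1 \<le> (indicator S (x + w) + indicator S x :: ennreal)"
            by (auto simp: indicator_def)
          from mult_left_mono[OF this, of "ennreal (min 1 (norm w / r) * norm w powr ?s)"] 1
          show ?thesis by simp
        next
          case False
          then show ?thesis using S[of x] S[of "w + x"] by (simp add: add.commute)
        qed
      qed
      also have "\<dots> = ennreal (min 1 (norm w / r) * norm w powr ?s) * (2 * emeasure lborel S)"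
      proof -
        have "(\<integral>\<^sup>+x. indicator S (x + w) \<partial>lborel) = emeasure lborel S"
          by (subst nn_integral_lborel_shift[of "indicator S"]) auto
        then show ?thesis by (simp add: nn_integral_cmult nn_integral_add mult_2)
      qed
      finally show "(\<integral>\<^sup>+x. ennreal (\<bar>u (w + x) - u x\<bar> * norm w powr ?s) \<partial>lborel)
        \<le> ennreal (min 1 (norm w / r) * norm w powr ?s) * (2 * emeasure lborel S)" .
    qed
    also have "\<dots> = (\<integral>\<^sup>+w. ennreal (min 1 (norm (w :: real ^ 'n) / r) * norm w powr ?s) \<partial>lborel) * (2 * emeasure lborel S)"
      by (rule nn_integral_multc) measurable
    also have "\<dots> \<le> ennreal (C * r powr (- \<alpha>)) * (2 * emeasure lborel S)"
      using C(2)[OF r] by (rule mult_right_mono) simp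
    finally show ?thesis by (simp add: mult.commute)
  qed
  show thesis by (rule that[OF C(1) 1 2])
qed

text \<open>A substitute for Hoelder's inequality when E is controlled in the supremum and L^1
  norms, with \<delta> left free for optimisation. Pointwise, if E \<le> \<delta> |f|^(p-1) then |f|
  E is at most \<delta> |f|^p; otherwise |f|^(p-1) < E / \<delta> \<le> M / \<delta>, which bounds
  |f| by a constant.\<close>

lemma nn_integral_mult_le_weighted:
  fixes f :: "'a::euclidean_space \<Rightarrow> real" and E :: "'a \<Rightarrow> ennreal"
  assumes p: "p > 1" and \<delta>: "\<delta> > 0" and f: "f \<in> borel_measurable lebesgue"
    and E[measurable]: "E \<in> borel_measurable borel" and M: "\<And>x. E x \<le> ennreal M" "M \<ge> 0"
  shows "(\<integral>\<^sup>+x. ennreal \<bar>f x\<bar> * E x \<partial>lebesgue)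
    \<le> ennreal \<delta> * (\<integral>\<^sup>+x. ennreal (\<bar>f x\<bar> powr p) \<partial>lebesgue)
      + ennreal ((M / \<delta>) powr (1 / (p - 1))) * (\<integral>\<^sup>+x. E x \<partial>lborel)"
proof -
  note f[measurable]
  have EL[measurable]: "E \<in> borel_measurable lebesgue" using E by (simp add: measurable_completion)
  have "ennreal \<bar>f x\<bar> * E x \<le> ennreal \<delta> * ennreal (\<bar>f x\<bar> powr p) + ennreal ((M / \<delta>) powr (1 / (p - 1))) * E x" for x
  proof -
    have "E x \<noteq> top" using M(1)[of x] by (metis ennreal_neq_top neq_top_trans)
    then obtain e where e: "E x = ennreal e" "e \<ge> 0" by (cases "E x") auto
    have eM: "e \<le> M" using M(1)[of x] M(2) e by simp
    have "\<bar>f x\<bar> * e \<le> \<delta> * \<bar>f x\<bar> powr p + (M / \<delta>) powr (1 / (p - 1)) * e"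
    proof (cases "e \<le> \<delta> * \<bar>f x\<bar> powr (p - 1)")
      case True
      have "\<bar>f x\<bar> * e \<le> \<bar>f x\<bar> * (\<delta> * \<bar>f x\<bar> powr (p - 1))" using True by (rule mult_left_mono) simp
      also have "\<dots> = \<delta> * \<bar>f x\<bar> powr p" using p by (cases "f x = 0") (auto simp: powr_mult_base)
      finally show ?thesis using e by (simp add: add_increasing2)
    next
      case False
      then have "\<bar>f x\<bar> powr (p - 1) \<le> e / \<delta>" using \<delta> by (simp add: field_simps)
      also have "\<dots> \<le> M / \<delta>" using eM \<delta> by (simp add: divide_right_mono)
      finally have "(\<bar>f x\<bar> powr (p - 1)) powr (1 / (p - 1)) \<le> (M / \<delta>) powr (1 / (p - 1))"
        using p by (intro powr_mono2) auto
      then have "\<bar>f x\<bar> \<le> (M / \<delta>) powr (1 / (p - 1))" using p by (simp add: powr_powr)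
      then have "\<bar>f x\<bar> * e \<le> (M / \<delta>) powr (1 / (p - 1)) * e" using e by (intro mult_right_mono)
      then show ?thesis using \<delta> by (simp add: add_increasing)
    qed
    then have "ennreal (\<bar>f x\<bar> * e) \<le> ennreal (\<delta> * \<bar>f x\<bar> powr p + (M / \<delta>) powr (1 / (p - 1)) * e)" by (rule ennreal_leI)
    then show ?thesis using e \<delta> by (simp add: ennreal_mult)
  qed
  then have "(\<integral>\<^sup>+x. ennreal \<bar>f x\<bar> * E x \<partial>lebesgue)
     \<le> (\<integral>\<^sup>+x. ennreal \<delta> * ennreal (\<bar>f x\<bar> powr p) + ennreal ((M / \<delta>) powr (1 / (p - 1))) * E x \<partial>lebesgue)"
    by (intro nn_integral_mono)
  also have "\<dots> = ennreal \<delta> * (\<integral>\<^sup>+x. ennreal (\<bar>f x\<bar> powr p) \<partial>lebesgue)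
      + ennreal ((M / \<delta>) powr (1 / (p - 1))) * (\<integral>\<^sup>+x. E x \<partial>lebesgue)"
    by (subst nn_integral_add) (auto simp: nn_integral_cmult)
  finally show ?thesis by (simp add: nn_integral_completion)
qed

section \<open>Cutoffs and the decay of their error against functions in L^p\<close>

definition cutoff :: "real \<Rightarrow> 'a::real_normed_vector \<Rightarrow> real" where
  "cutoff r x = max 0 (min 1 (2 - norm x / r))"

lemma borel_measurable_cutoff[measurable]: "cutoff r \<in> borel_measurable borel"
  unfolding cutoff_def[abs_def] by measurable

lemma cutoff_range: "0 \<le> cutoff r x" "cutoff r x \<le> 1"
  by (auto simp: cutoff_def)

lemma cutoff_eq_1: "r > 0 \<Longrightarrow> norm x \<le> r \<Longrightarrow> cutoff r x = 1"
  by (simp add: cutoff_def)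

lemma cutoff_eq_0: "r > 0 \<Longrightarrow> x \<notin> cball 0 (2 * r) \<Longrightarrow> cutoff r x = 0"
  by (simp add: cutoff_def field_simps)

lemma cutoff_diff_le:
  assumes "r > 0"
  shows "\<bar>cutoff r y - cutoff r x\<bar> \<le> min 1 (norm (y - x) / r)"
proof -
  have "\<bar>norm y / r - norm x / r\<bar> = \<bar>norm y - norm x\<bar> / r"
    using assms by (simp add: diff_divide_distrib[symmetric] abs_divide)
  also have "\<dots> \<le> norm (y - x) / r"
    using assms norm_triangle_ineq3[of y x] by (simp add: divide_right_mono)
  finally show ?thesis unfolding cutoff_def by (auto simp: abs_le_iff)
qed

lemma tendsto_powr_Suc_0:
  assumes "s > 0" shows "(\<lambda>k. K * real (Suc k) powr (- s)) \<longlonglongrightarrow> 0"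
proof -
  have "(\<lambda>k. real (Suc k) powr (- s)) \<longlonglongrightarrow> 0"
    using assms by (intro tendsto_neg_powr filterlim_compose[OF filterlim_real_sequentially filterlim_Suc]) auto
  from tendsto_mult_right_zero[OF this] show ?thesis by simp
qed

lemma Lp_nn_integral_finite:
  assumes "f \<in> Lp p" shows "(\<integral>\<^sup>+x. ennreal (\<bar>f x\<bar> powr p) \<partial>lebesgue) < \<infinity>"
  using assms by (auto simp: Lp_def integrable_iff_bounded)

text \<open>Supplies the integrability that allows the Bochner integrals in
  \<open>monotone_test_field_le\<close> to be split. For p = 1 the supremum bound is enough; for p >
  1 it is combined with the L^1 bound, and at a fixed scale the choice \<delta> = 1 will do.\<close>

lemma nn_integral_nonlocal_gradient_finite:
  fixes f :: "real ^ 'n \<Rightarrow> real"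
  assumes \<alpha>: "0 < \<alpha>" "\<alpha> < 1" and p: "1 \<le> p" and f: "f \<in> Lp p"
    and r: "r > 0" and u: "u \<in> borel_measurable borel"
    and lip: "\<And>x y. \<bar>u y - u x\<bar> \<le> min 1 (norm (y - x) / r)"
    and S: "S \<in> sets borel" "emeasure lborel S < \<infinity>" "\<And>x. x \<notin> S \<Longrightarrow> u x = 0"
  shows "(\<integral>\<^sup>+x. ennreal \<bar>f x\<bar> * nonlocal_gradient \<alpha> u x \<partial>lebesgue) < \<infinity>"
proof -
  obtain C where C: "C > 0"
    and C1: "\<And>x. nonlocal_gradient \<alpha> u x \<le> ennreal (C * r powr (- \<alpha>))"
    and C2: "(\<integral>\<^sup>+x. nonlocal_gradient \<alpha> u x \<partial>lborel) \<le> 2 * emeasure lborel S * ennreal (C * r powr (- \<alpha>))"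
    using nonlocal_gradient_bounds[OF \<alpha>, where 'n = 'n] r u S(1,3) lip by metis
  have fm[measurable]: "f \<in> borel_measurable lebesgue" using f by (simp add: Lp_def)
  note F = Lp_nn_integral_finite[OF f]
  show ?thesis
  proof (cases "p = 1")
    case True
    have "(\<integral>\<^sup>+x. ennreal \<bar>f x\<bar> * nonlocal_gradient \<alpha> u x \<partial>lebesgue)
       \<le> (\<integral>\<^sup>+x. ennreal (\<bar>f x\<bar> powr p) * ennreal (C * r powr (- \<alpha>)) \<partial>lebesgue)"
      using C1 True by (intro nn_integral_mono mult_mono) auto
    also have "\<dots> = (\<integral>\<^sup>+x. ennreal (\<bar>f x\<bar> powr p) \<partial>lebesgue) * ennreal (C * r powr (- \<alpha>))"
      by (rule nn_integral_multc) measurable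
    also have "\<dots> < \<infinity>" using F by (simp add: ennreal_mult_less_top)
    finally show ?thesis .
  next
    case False
    then have "p > 1" using p by simp
    have "(\<integral>\<^sup>+x. ennreal \<bar>f x\<bar> * nonlocal_gradient \<alpha> u x \<partial>lebesgue)
      \<le> ennreal 1 * (\<integral>\<^sup>+x. ennreal (\<bar>f x\<bar> powr p) \<partial>lebesgue)
      + ennreal ((C * r powr (- \<alpha>) / 1) powr (1 / (p - 1))) * (\<integral>\<^sup>+x. nonlocal_gradient \<alpha> u x \<partial>lborel)"
      using C C1 u by (intro nn_integral_mult_le_weighted[OF \<open>p > 1\<close>]) auto
    also have "\<dots> < \<infinity>"
    proof -
      have "2 * emeasure lborel S * ennreal (C * r powr (- \<alpha>)) < \<infinity>"
        using S(2) by (simp add: ennreal_mult_less_top)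
      then have "(\<integral>\<^sup>+x. nonlocal_gradient \<alpha> u x \<partial>lborel) < \<infinity>" by (rule le_less_trans[OF C2])
      then show ?thesis using F by (simp add: ennreal_mult_less_top)
    qed
    finally show ?thesis .
  qed
qed

text \<open>This is where \<open>p < n / (n - \<alpha>)\<close> is needed: the \<open>L\<^sup>q\<close> norm of the nonlocal gradient
  of the cutoff at scale \<open>r\<close> behaves like \<open>r\<^bsup>n/q - \<alpha>\<^esup>\<close>, where \<open>q\<close> is conjugate to \<open>p\<close>.\<close>

lemma nonlocal_gradient_cutoff_tendsto_0:
  fixes f :: "real ^ 'n \<Rightarrow> real"
  assumes \<alpha>: "0 < \<alpha>" "\<alpha> < 1" and p: "1 \<le> p" "p < real CARD('n) / (real CARD('n) - \<alpha>)" and f: "f \<in> Lp p"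
  shows "(\<lambda>k. \<integral>\<^sup>+x. ennreal \<bar>f x\<bar> * nonlocal_gradient \<alpha> (cutoff (real (Suc k))) x \<partial>lebesgue) \<longlonglongrightarrow> 0"
proof -
  define I where "I k = (\<integral>\<^sup>+x. ennreal \<bar>f x\<bar> * nonlocal_gradient \<alpha> (cutoff (real (Suc k))) x \<partial>lebesgue)" for k
  have fm[measurable]: "f \<in> borel_measurable lebesgue" using f by (simp add: Lp_def)
  define F where "F = enn2real (\<integral>\<^sup>+x. ennreal (\<bar>f x\<bar> powr p) \<partial>lebesgue)"
  have F: "(\<integral>\<^sup>+x. ennreal (\<bar>f x\<bar> powr p) \<partial>lebesgue) = ennreal F" "F \<ge> 0"
    using Lp_nn_integral_finite[OF f] by (simp_all add: F_def)
  obtain C where C: "C > 0"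
    and C1: "\<And>k x. nonlocal_gradient \<alpha> (cutoff (real (Suc k)) :: real ^ 'n \<Rightarrow> real) x \<le> ennreal (C * real (Suc k) powr (- \<alpha>))"
    and C2: "\<And>k. (\<integral>\<^sup>+x. nonlocal_gradient \<alpha> (cutoff (real (Suc k)) :: real ^ 'n \<Rightarrow> real) x \<partial>lborel)
        \<le> 2 * emeasure lborel (cball (0 :: real ^ 'n) (2 * real (Suc k))) * ennreal (C * real (Suc k) powr (- \<alpha>))"
  proof (rule nonlocal_gradient_bounds[OF \<alpha>, where 'n = 'n])
    fix C :: real
    assume a: "0 < C"
      "\<And>(u :: real^'n \<Rightarrow> real) r x. r > 0 \<Longrightarrow> u \<in> borel_measurable borel \<Longrightarrow>
        (\<And>x y. \<bar>u y - u x\<bar> \<le> min 1 (norm (y - x) / r)) \<Longrightarrow>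
        nonlocal_gradient \<alpha> u x \<le> ennreal (C * r powr (- \<alpha>))"
      "\<And>(u :: real^'n \<Rightarrow> real) r S. r > 0 \<Longrightarrow> u \<in> borel_measurable borel \<Longrightarrow> S \<in> sets borel \<Longrightarrow>
        (\<And>x y. \<bar>u y - u x\<bar> \<le> min 1 (norm (y - x) / r)) \<Longrightarrow> (\<And>x. x \<notin> S \<Longrightarrow> u x = 0) \<Longrightarrow>
        (\<integral>\<^sup>+x. nonlocal_gradient \<alpha> u x \<partial>lborel) \<le> 2 * emeasure lborel S * ennreal (C * r powr (- \<alpha>))"
    have r: "real (Suc k) > 0" for k by simp
    show thesis
      by (rule that[OF a(1) a(2)[OF r borel_measurable_cutoff cutoff_diff_le[OF r]] a(3)[OF r borel_measurable_cutoff _ cutoff_diff_le[OF r] cutoff_eq_0[OF r]]]) auto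
  qed
  have "I \<longlonglongrightarrow> 0"
  proof (cases "p = 1")
    case True
    have "I k \<le> ennreal (F * C * real (Suc k) powr (- \<alpha>))" for k
    proof -
      have "I k \<le> (\<integral>\<^sup>+x. ennreal (\<bar>f x\<bar> powr p) * ennreal (C * real (Suc k) powr (- \<alpha>)) \<partial>lebesgue)"
        unfolding I_def using C1 True by (intro nn_integral_mono mult_mono) auto
      also have "\<dots> = ennreal F * ennreal (C * real (Suc k) powr (- \<alpha>))"
        unfolding F(1)[symmetric] by (rule nn_integral_multc) measurable
      also have "\<dots> = ennreal (F * C * real (Suc k) powr (- \<alpha>))"
        using F(2) by (simp only: mult.assoc ennreal_mult')
      finally show ?thesis .
    qed
    moreover have "(\<lambda>k. ennreal (F * C * real (Suc k) powr (- \<alpha>))) \<longlonglongrightarrow> 0"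
      using tendsto_ennrealI[OF tendsto_powr_Suc_0[OF \<alpha>(1), of "F * C"]] by (simp only: ennreal_0)
    ultimately show ?thesis
      by (rule tendsto_sandwich[OF always_eventually always_eventually tendsto_const, OF allI allI, rotated]) simp_all
  next
    case False
    then have p1: "p > 1" using p(1) by simp
    define n where "n = real CARD('n)"
    have n: "n \<ge> 1" by (simp add: n_def Suc_leI)
    \<comment> \<open>With \<delta> = R^(-\<tau>) the first term of
      \<open>nn_integral_mult_le_weighted\<close> is of order R^(-\<tau>) and the second of order
      R^(\<tau>\<beta> - \<sigma>). Here \<sigma> > 0 is a rewriting of p < n / (n - \<alpha>), and
      \<tau> is chosen with \<tau>\<beta> = \<sigma>/2, so that both terms decay.\<close>
    define \<beta> where "\<beta> = 1 / (p - 1)"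
    define \<sigma> where "\<sigma> = \<alpha> * \<beta> + \<alpha> - n"
    define \<tau> where "\<tau> = \<sigma> * (p - 1) / 2"
    define V where "V = unit_ball_vol n"
    have V: "V \<ge> 0" using n by (simp add: V_def)
    have \<beta>: "\<beta> > 0" using p1 by (simp add: \<beta>_def)
    have \<sigma>: "\<sigma> > 0"
    proof -
      have "p * (n - \<alpha>) < n" using p(2) n \<alpha> by (simp add: n_def[symmetric] pos_less_divide_eq)
      then have "0 < \<alpha> * p - n * (p - 1)" by (simp add: algebra_simps)
      then have "0 < (\<alpha> * p - n * (p - 1)) / (p - 1)" using p1 by (intro divide_pos_pos) auto
      also have "\<dots> = \<sigma>" using p1 by (simp add: \<sigma>_def \<beta>_def field_simps)
      finally show ?thesis .
    qed
    have "(p - 1) * \<beta> = 1" using p1 by (simp add: \<beta>_def)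
    then have "\<tau> * \<beta> = \<sigma> / 2" by (simp add: \<tau>_def mult.assoc)
    moreover have "\<tau> > 0" using \<sigma> p1 by (simp add: \<tau>_def)
    ultimately have \<tau>: "\<tau> > 0" "\<tau> * \<beta> = \<sigma> / 2" by (simp_all)
    define K where "K = C powr \<beta> * (2 * V * 2 powr n * C)"
    have "I k \<le> ennreal (F * real (Suc k) powr (- \<tau>)) + ennreal (K * real (Suc k) powr (- (\<sigma> / 2)))" for k
    proof -
      define R where "R = real (Suc k)"
      have R: "R > 0" by (simp add: R_def)
      have "I k \<le> ennreal (R powr (- \<tau>)) * (\<integral>\<^sup>+x. ennreal (\<bar>f x\<bar> powr p) \<partial>lebesgue)
        + ennreal ((C * R powr (- \<alpha>) / R powr (- \<tau>)) powr (1 / (p - 1))) * (\<integral>\<^sup>+x. nonlocal_gradient \<alpha> (cutoff R :: real ^ 'n \<Rightarrow> real) x \<partial>lborel)"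
        unfolding I_def R_def[symmetric] using C C1[of k, folded R_def] R
        by (intro nn_integral_mult_le_weighted[OF p1]) simp_all
      also have "\<dots> \<le> ennreal (F * R powr (- \<tau>)) + ennreal (K * R powr (- (\<sigma> / 2)))"
      proof (rule add_mono)
        show "ennreal (R powr (- \<tau>)) * (\<integral>\<^sup>+x. ennreal (\<bar>f x\<bar> powr p) \<partial>lebesgue) \<le> ennreal (F * R powr (- \<tau>))"
          using F by (simp add: ennreal_mult mult.commute)
        have "(\<integral>\<^sup>+x. nonlocal_gradient \<alpha> (cutoff R :: real ^ 'n \<Rightarrow> real) x \<partial>lborel)
          \<le> 2 * emeasure lborel (cball (0 :: real ^ 'n) (2 * R)) * ennreal (C * R powr (- \<alpha>))"
          unfolding R_def by (rule C2)
        also have "emeasure lborel (cball (0 :: real ^ 'n) (2 * R)) = ennreal (V * (2 * R) powr n)"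
          using R by (simp add: emeasure_cball V_def n_def powr_realpow)
        also have "2 * ennreal (V * (2 * R) powr n) * ennreal (C * R powr (- \<alpha>)) = ennreal (2 * (V * (2 * R) powr n) * (C * R powr (- \<alpha>)))"
          using V C R by (simp add: ennreal_mult)
        finally have le: "(\<integral>\<^sup>+x. nonlocal_gradient \<alpha> (cutoff R :: real ^ 'n \<Rightarrow> real) x \<partial>lborel)
          \<le> ennreal (2 * (V * (2 * R) powr n) * (C * R powr (- \<alpha>)))" .
        have eq: "(C * R powr (- \<alpha>) / R powr (- \<tau>)) powr \<beta> * (2 * (V * (2 * R) powr n) * (C * R powr (- \<alpha>)))
           = K * R powr (- (\<sigma> / 2))"
        proof -
          have "C * R powr (- \<alpha>) / R powr (- \<tau>) = C * R powr (\<tau> - \<alpha>)"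
            using R by (simp add: powr_diff powr_minus divide_simps)
          also have "\<dots> powr \<beta> = C powr \<beta> * R powr (\<tau> * \<beta> - \<alpha> * \<beta>)"
            using C R by (simp add: powr_mult powr_powr left_diff_distrib)
          finally have 1: "(C * R powr (- \<alpha>) / R powr (- \<tau>)) powr \<beta> = C powr \<beta> * R powr (\<tau> * \<beta> - \<alpha> * \<beta>)" .
          have 2: "(2 * R) powr n = 2 powr n * R powr n" using R by (simp add: powr_mult)
          have "R powr (\<tau> * \<beta> - \<alpha> * \<beta>) * (R powr n * R powr (- \<alpha>)) = R powr (\<tau> * \<beta> - \<alpha> * \<beta> + (n + - \<alpha>))"
            by (simp only: powr_add)
          also have "\<tau> * \<beta> - \<alpha> * \<beta> + (n + - \<alpha>) = - (\<sigma> / 2)" unfolding \<tau>(2) by (simp add: \<sigma>_def field_simps)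
          finally have 3: "R powr (- (\<sigma> / 2)) = R powr (\<tau> * \<beta> - \<alpha> * \<beta>) * (R powr n * R powr (- \<alpha>))" by simp
          show ?thesis unfolding 1 2 3 K_def by (simp only: mult_ac)
        qed
        have "ennreal ((C * R powr (- \<alpha>) / R powr (- \<tau>)) powr \<beta>) * (\<integral>\<^sup>+x. nonlocal_gradient \<alpha> (cutoff R :: real ^ 'n \<Rightarrow> real) x \<partial>lborel)
          \<le> ennreal ((C * R powr (- \<alpha>) / R powr (- \<tau>)) powr \<beta>) * ennreal (2 * (V * (2 * R) powr n) * (C * R powr (- \<alpha>)))"
          using le by (rule mult_left_mono) simp
        also have "\<dots> = ennreal (K * R powr (- (\<sigma> / 2)))"
          unfolding eq[symmetric] using V C by (intro ennreal_mult[symmetric]) auto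
        finally show "ennreal ((C * R powr (- \<alpha>) / R powr (- \<tau>)) powr (1 / (p - 1))) * (\<integral>\<^sup>+x. nonlocal_gradient \<alpha> (cutoff R :: real ^ 'n \<Rightarrow> real) x \<partial>lborel)
          \<le> ennreal (K * R powr (- (\<sigma> / 2)))" by (simp add: \<beta>_def)
      qed
      finally show ?thesis by (simp add: R_def)
    qed
    moreover have "(\<lambda>k. ennreal (F * real (Suc k) powr (- \<tau>)) + ennreal (K * real (Suc k) powr (- (\<sigma> / 2)))) \<longlonglongrightarrow> 0"
    proof -
      have "\<sigma> / 2 > 0" using \<sigma> by simp
      from tendsto_add[OF tendsto_ennrealI[OF tendsto_powr_Suc_0[OF \<tau>(1), of F]] tendsto_ennrealI[OF tendsto_powr_Suc_0[OF this, of K]]]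
      show ?thesis by simp
    qed
    ultimately show ?thesis
      by (rule tendsto_sandwich[OF always_eventually always_eventually tendsto_const, OF allI allI, rotated]) simp_all
  qed
  then show ?thesis unfolding I_def .
qed

section \<open>Integration against vector measures\<close>

definition borel_partition :: "'a::topological_space set \<Rightarrow> (nat \<Rightarrow> 'a set) \<Rightarrow> bool" where
  "borel_partition A P \<longleftrightarrow> range P \<subseteq> sets borel \<and> disjoint_family P \<and> (\<Union>i. P i) = A"

text \<open>The additivity half of \<open>finite_radon_measure\<close>, split off so that it can be
  stated for \<open>D\<close> and for its real components alike.\<close>

definition borel_additive :: "('a::topological_space set \<Rightarrow> 'b::real_normed_vector) \<Rightarrow> bool" where
  "borel_additive D \<longleftrightarrow> (\<forall>A :: nat \<Rightarrow> 'a set. range A \<subseteq> sets borel \<longrightarrow> disjoint_family A \<longrightarrow>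
     (\<lambda>i. D (A i)) sums D (\<Union>i. A i))"

lemma borel_additiveD:
  "borel_additive D \<Longrightarrow> borel_partition A P \<Longrightarrow> (\<lambda>i. D (P i)) sums D A"
  by (auto simp: borel_additive_def borel_partition_def)

lemma total_variation_eq:
  "total_variation D A = (SUP P\<in>Collect (borel_partition A). \<Sum>i. ennreal (norm (D (P i))))"
  by (simp add: total_variation_def borel_partition_def[abs_def])

lemma total_variation_upper:
  "borel_partition A P \<Longrightarrow> (\<Sum>i. ennreal (norm (D (P i)))) \<le> total_variation D A"
  unfolding total_variation_eq by (rule SUP_upper) simp

lemma borel_partition_binaryset:
  "A \<in> sets borel \<Longrightarrow> B \<in> sets borel \<Longrightarrow> A \<inter> B = {} \<Longrightarrow> borel_partition (A \<union> B) (binaryset A B)"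
  by (auto simp: borel_partition_def binaryset_def disjoint_family_on_def UN_binaryset_eq[unfolded binaryset_def] split: if_splits)

lemma borel_additive_empty:
  assumes "borel_additive D" shows "D {} = 0"
proof -
  have "(\<lambda>i::nat. D {}) sums D {}"
    using borel_additiveD[OF assms, of "{}" "\<lambda>_. {}"] by (simp add: borel_partition_def disjoint_family_on_def)
  then show ?thesis using summable_const_iff sums_summable by blast
qed

lemma norm_le_total_variation:
  assumes "borel_additive D" "B \<in> sets borel" "A \<in> sets borel" "B \<subseteq> A"
  shows "ennreal (norm (D B)) \<le> total_variation D A"
proof -
  have P: "borel_partition A (binaryset B (A - B))"
    using borel_partition_binaryset[of B "A - B"] assms by (simp add: Un_absorb1)
  have "ennreal (norm (D B)) = (\<Sum>i\<in>{0}. ennreal (norm (D (binaryset B (A - B) i))))"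
    by (simp add: binaryset_def)
  also have "\<dots> \<le> (\<Sum>i. ennreal (norm (D (binaryset B (A - B) i))))"
    by (rule sum_le_suminf) auto
  also have "\<dots> \<le> total_variation D A" by (rule total_variation_upper[OF P])
  finally show ?thesis .
qed

text \<open>Partitions of the pieces of a countable partition, reindexed by the pairing function,
  form a single sequence that is again a partition of U and so competes in the supremum. Both
  monotonicity and one half of countable additivity follow from this.\<close>

lemma total_variation_refine:
  fixes Q :: "nat \<Rightarrow> nat \<Rightarrow> 'a::topological_space set"
  assumes A: "borel_partition U A" and Q: "\<And>i. borel_partition (A i) (Q i)"
  shows "(\<Sum>i. \<Sum>j. ennreal (norm (D (Q i j)))) \<le> total_variation D U"
proof -
  have Qm: "Q i j \<in> sets borel" for i j
    using Q[of i] unfolding borel_partition_def image_subset_iff by blast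
  define R where "R k = case_prod Q (prod_decode k)" for k
  have "disjoint_family R"
  proof (unfold disjoint_family_on_def, intro ballI impI)
    fix k l :: nat assume "k \<noteq> l"
    obtain i j i' j' where kl: "prod_decode k = (i, j)" "prod_decode l = (i', j')" by fastforce
    have ne: "(i, j) \<noteq> (i', j')" using \<open>k \<noteq> l\<close> kl by (metis prod_decode_eq)
    have sub: "Q i j \<subseteq> A i" "Q i' j' \<subseteq> A i'" using Q unfolding borel_partition_def by auto
    show "R k \<inter> R l = {}"
    proof (cases "i = i'")
      case True
      then show ?thesis using ne Q[of i] by (auto simp: R_def kl borel_partition_def disjoint_family_on_def)
    next
      case False
      then have "A i \<inter> A i' = {}" using A by (auto simp: borel_partition_def disjoint_family_on_def)
      then show ?thesis using sub by (auto simp: R_def kl)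
    qed
  qed
  moreover have "range R \<subseteq> sets borel"
    using Qm by (simp add: R_def image_subset_iff split: prod.split)
  moreover have "(\<Union>k. R k) = (\<Union>i. \<Union>j. Q i j)"
  proof -
    have "Q i j = R (prod_encode (i, j))" for i j by (simp add: R_def)
    then have "Q i j \<subseteq> (\<Union>k. R k)" for i j by (metis UN_upper UNIV_I)
    moreover have "R k \<subseteq> (\<Union>i. \<Union>j. Q i j)" for k
      by (cases "prod_decode k") (auto simp: R_def)
    ultimately show ?thesis by (intro antisym UN_least)
  qed
  ultimately have "borel_partition U R" using A Q by (simp add: borel_partition_def)
  from total_variation_upper[OF this, of D]
  have "(\<Sum>k. ennreal (norm (D (case_prod Q (prod_decode k))))) \<le> total_variation D U" by (simp add: R_def)
  also have "(\<Sum>k. ennreal (norm (D (case_prod Q (prod_decode k))))) = (\<Sum>i. \<Sum>j. ennreal (norm (D (Q i j))))"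
    by (rule suminf_ennreal_2dimen[where f = "\<lambda>p. ennreal (norm (D (case_prod Q p)))"]) simp
  finally show ?thesis .
qed

lemma total_variation_mono:
  assumes [measurable]: "A \<in> sets borel" "B \<in> sets borel" and "A \<subseteq> B"
  shows "total_variation D A \<le> total_variation D B"
  unfolding total_variation_eq[of D A]
proof (rule SUP_least)
  fix P assume "P \<in> Collect (borel_partition A)"
  then have P: "borel_partition A P" by simp
  \<comment> \<open>In the partition A, B - A, {}, {}, ... of B only the piece A is split, along
    \<open>P\<close>; every other piece is kept and padded with empty sets.\<close>
  define Q where "Q i = (if i = 0 then P else binaryset (binaryset A (B - A) i) {})" for i :: nat
  have "borel_partition (A \<union> (B - A)) (binaryset A (B - A))"
    by (rule borel_partition_binaryset) auto
  then have 1: "borel_partition B (binaryset A (B - A))" using assms by (simp add: Un_absorb1)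
  have 2: "borel_partition (binaryset A (B - A) i) (Q i)" for i
  proof (cases "i = 0")
    case False
    then show ?thesis
      using borel_partition_binaryset[of "binaryset A (B - A) i" "{}"] by (simp add: Q_def binaryset_def)
  qed (use P in \<open>simp add: Q_def binaryset_def\<close>)
  have "(\<Sum>j. ennreal (norm (D (P j)))) = (\<Sum>i\<in>{0}. \<Sum>j. ennreal (norm (D (Q i j))))"
    by (simp add: Q_def)
  also have "\<dots> \<le> (\<Sum>i. \<Sum>j. ennreal (norm (D (Q i j))))" by (rule sum_le_suminf) auto
  also have "\<dots> \<le> total_variation D B" by (rule total_variation_refine[OF 1 2])
  finally show "(\<Sum>j. ennreal (norm (D (P j)))) \<le> total_variation D B" .
qed

lemma ennreal_suminf_swap:
  fixes f :: "nat \<Rightarrow> nat \<Rightarrow> ennreal"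
  shows "(\<Sum>i. \<Sum>j. f i j) = (\<Sum>j. \<Sum>i. f i j)"
  using nn_integral_suminf[of "\<lambda>j i. f i j" "count_space UNIV"]
  by (simp add: nn_integral_count_space_nat)

lemma norm_sums_le_ennreal:
  fixes f :: "nat \<Rightarrow> 'b::real_normed_vector"
  assumes "f sums s"
  shows "ennreal (norm s) \<le> (\<Sum>i. ennreal (norm (f i)))"
proof (rule LIMSEQ_le_const2)
  show "(\<lambda>n. ennreal (norm (\<Sum>i<n. f i))) \<longlonglongrightarrow> ennreal (norm s)"
    using assms unfolding sums_def by (intro tendsto_ennrealI tendsto_norm)
  have "ennreal (norm (\<Sum>i<n. f i)) \<le> (\<Sum>i. ennreal (norm (f i)))" for n
  proof -
    have "ennreal (norm (\<Sum>i<n. f i)) \<le> ennreal (\<Sum>i<n. norm (f i))" by (intro ennreal_leI norm_sum)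
    also have "\<dots> = (\<Sum>i<n. ennreal (norm (f i)))" by (simp add: sum_ennreal)
    also have "\<dots> \<le> (\<Sum>i. ennreal (norm (f i)))" by (rule sum_le_suminf) auto
    finally show ?thesis .
  qed
  then show "\<exists>N. \<forall>n\<ge>N. ennreal (norm (\<Sum>i<n. f i)) \<le> (\<Sum>i. ennreal (norm (f i)))" by blast
qed

text \<open>For \<le>, nearly optimal partitions of the pieces are glued together; finiteness is
  what makes approximation up to an additive error possible. For \<ge>, any partition of U is cut
  along the A i, the triangle inequality is applied to each of its sets, and the order of summation
  is exchanged.\<close>

lemma total_variation_countably_additive:
  assumes D: "borel_additive D" and fin: "total_variation D UNIV < \<infinity>"
    and A: "borel_partition U A"
  shows "(\<Sum>i. total_variation D (A i)) = total_variation D U"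
proof (rule antisym)
  have Am: "A i \<in> sets borel" for i using A by (auto simp: borel_partition_def)
  have fin': "total_variation D (A i) < \<infinity>" for i
    using total_variation_mono[OF Am, of UNIV i D] fin by (simp add: less_le_trans le_less_trans)
  show "(\<Sum>i. total_variation D (A i)) \<le> total_variation D U"
  proof (rule ennreal_le_epsilon)
    fix e :: real assume e: "e > 0"
    \<comment> \<open>The tolerance for piece i is e / 2^(i+1), so that the tolerances add up to
      e.\<close>
    have "\<exists>P. borel_partition (A i) P \<and>
        total_variation D (A i) \<le> (\<Sum>j. ennreal (norm (D (P j)))) + ennreal (e * (1/2) ^ Suc i)" for i
    proof -
      have ne: "Collect (borel_partition (A i)) \<noteq> {}"
        using borel_partition_binaryset[of "A i" "{}"] Am by auto
      have "\<exists>P\<in>Collect (borel_partition (A i)).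
          total_variation D (A i) < (\<Sum>j. ennreal (norm (D (P j)))) + ennreal (e * (1/2) ^ Suc i)"
        using fin'[of i] e ne
        by (intro SUP_approx_ennreal[OF _ ne total_variation_eq]) auto
      then show ?thesis by (auto intro: less_imp_le)
    qed
    then obtain Q where Q: "\<And>i. borel_partition (A i) (Q i)"
      "\<And>i. total_variation D (A i) \<le> (\<Sum>j. ennreal (norm (D (Q i j)))) + ennreal (e * (1/2) ^ Suc i)"
      by metis
    have "(\<Sum>i. total_variation D (A i)) \<le> (\<Sum>i. (\<Sum>j. ennreal (norm (D (Q i j)))) + ennreal (e * (1/2) ^ Suc i))"
      by (intro suminf_le Q) auto
    also have "\<dots> = (\<Sum>i. \<Sum>j. ennreal (norm (D (Q i j)))) + (\<Sum>i. ennreal (e * (1/2) ^ Suc i))"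
      by (intro suminf_add[symmetric]) auto
    also have "(\<Sum>i. ennreal (e * (1/2) ^ Suc i)) = ennreal (e * 1)"
      using e by (intro suminf_ennreal_eq sums_mult power_half_series) auto
    also have "(\<Sum>i. \<Sum>j. ennreal (norm (D (Q i j)))) \<le> total_variation D U"
      by (rule total_variation_refine[OF A Q(1)])
    finally show "(\<Sum>i. total_variation D (A i)) \<le> total_variation D U + ennreal e"
      by simp
  qed
  show "total_variation D U \<le> (\<Sum>i. total_variation D (A i))"
    unfolding total_variation_eq[of D U]
  proof (rule SUP_least)
    fix P assume "P \<in> Collect (borel_partition U)"
    then have P: "borel_partition U P" by simp
    have PA: "P j \<in> sets borel" "(\<Union>j. P j) = U" "(\<Union>i. A i) = U"
      "m \<noteq> n \<Longrightarrow> P m \<inter> P n = {}" "m \<noteq> n \<Longrightarrow> A m \<inter> A n = {}" for j m n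
      using P A by (simp_all add: borel_partition_def disjoint_family_on_def image_subset_iff)
    have sub: "P j \<subseteq> U" "A i \<subseteq> U" for i j
      using UN_upper[of j UNIV P] UN_upper[of i UNIV A] by (simp_all add: PA(2,3))
    have dis: "disjoint_family (\<lambda>i. P j \<inter> A i)" "disjoint_family (\<lambda>j. P j \<inter> A i)" for i j
      using PA(4,5) unfolding disjoint_family_on_def by fast+
    have un: "(\<Union>i. P j \<inter> A i) = P j" "(\<Union>j. P j \<inter> A i) = A i" for i j
      using sub[of j] sub(2)[of i] PA(2,3) by (simp_all add: Int_UN_distrib[symmetric] Int_UN_distrib2[symmetric] inf.absorb1 inf.absorb2)
    have part: "borel_partition (P j) (\<lambda>i. P j \<inter> A i)" "borel_partition (A i) (\<lambda>j. P j \<inter> A i)" for i j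
      using dis un PA(1) Am by (simp_all add: borel_partition_def image_subset_iff sets.Int)
    have "(\<Sum>j. ennreal (norm (D (P j)))) \<le> (\<Sum>j. \<Sum>i. ennreal (norm (D (P j \<inter> A i))))"
      by (intro suminf_le norm_sums_le_ennreal borel_additiveD[OF D] part) auto
    also have "\<dots> = (\<Sum>i. \<Sum>j. ennreal (norm (D (P j \<inter> A i))))" by (rule ennreal_suminf_swap)
    also have "\<dots> \<le> (\<Sum>i. total_variation D (A i))"
      by (intro suminf_le total_variation_upper part) auto
    finally show "(\<Sum>j. ennreal (norm (D (P j)))) \<le> (\<Sum>i. total_variation D (A i))" .
  qed
qed

section \<open>Jordan parts of a real-valued measure\<close>

text \<open>The sign c = 1 gives the positive and c = -1 the negative part. Nonnegativity of the set
  function is not cosmetic: \<open>ennreal\<close> truncates negative values to 0, which would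
  destroy additivity.\<close>

lemma jordan_part_measure:
  fixes m :: "'a::topological_space set \<Rightarrow> real"
  assumes m: "borel_additive m" and fin: "total_variation m UNIV < \<infinity>" and c: "\<bar>c\<bar> \<le> 1"
    and N: "N = measure_of UNIV (sets borel) (\<lambda>A. ennreal ((enn2real (total_variation m A) + c * m A) / 2))"
    and A: "A \<in> sets borel"
  shows "emeasure N A = ennreal ((enn2real (total_variation m A) + c * m A) / 2)"
    and "0 \<le> (enn2real (total_variation m A) + c * m A) / 2"
proof -
  have finA: "total_variation m B < \<infinity>" if "B \<in> sets borel" for B
    using total_variation_mono[OF that, of UNIV m] fin by (simp add: le_less_trans)
  have nonneg: "0 \<le> (enn2real (total_variation m B) + c * m B) / 2" if B: "B \<in> sets borel" for B
  proof -
    have "ennreal \<bar>m B\<bar> \<le> ennreal (enn2real (total_variation m B))"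
      using norm_le_total_variation[OF m B B] finA[OF B] by simp
    then have "\<bar>m B\<bar> \<le> enn2real (total_variation m B)" by (subst (asm) ennreal_le_iff) auto
    moreover have "\<bar>c * m B\<bar> \<le> \<bar>m B\<bar>" using c by (simp add: abs_mult mult_left_le_one_le)
    ultimately show ?thesis using abs_ge_minus_self[of "c * m B"] by simp
  qed
  show "0 \<le> (enn2real (total_variation m A) + c * m A) / 2" by (rule nonneg[OF A])
  show "emeasure N A = ennreal ((enn2real (total_variation m A) + c * m A) / 2)"
    unfolding N
  proof (rule emeasure_measure_of_sigma)
    show "sigma_algebra UNIV (sets (borel :: 'a measure))" by (metis sets.sigma_algebra_axioms space_borel)
    have "total_variation m {} = 0"
    proof -
      have "m (P i) = 0" if "borel_partition {} P" for P :: "nat \<Rightarrow> 'a set" and i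
        using that borel_additive_empty[OF m] by (simp add: borel_partition_def)
      then show ?thesis
        unfolding total_variation_eq by (intro antisym SUP_least) auto
    qed
    then show "positive (sets borel) (\<lambda>A. ennreal ((enn2real (total_variation m A) + c * m A) / 2))"
      by (simp add: positive_def borel_additive_empty[OF m])
    show "countably_additive (sets borel) (\<lambda>A. ennreal ((enn2real (total_variation m A) + c * m A) / 2))"
    proof (rule countably_additiveI)
      fix B :: "nat \<Rightarrow> 'a set" assume B: "range B \<subseteq> sets borel" "disjoint_family B" "\<Union> (range B) \<in> sets borel"
      then have P: "borel_partition (\<Union>(range B)) B" by (simp add: borel_partition_def)
      have Bm: "B i \<in> sets borel" for i using B by auto
      have eq: "(\<Sum>i. ennreal (enn2real (total_variation m (B i)))) = total_variation m (\<Union>(range B))"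
        using total_variation_countably_additive[OF m fin P] finA[OF Bm] by simp
      \<comment> \<open>Additivity of the variation is transferred from \<open>ennreal\<close> to a
        convergent real series, since only there can it be added to the signed series of m.\<close>
      have "summable (\<lambda>i. enn2real (total_variation m (B i)))"
        by (rule summable_suminf_not_top) (use eq finA[OF B(3)] in auto)
      moreover from this have "(\<Sum>i. enn2real (total_variation m (B i))) = enn2real (total_variation m (\<Union>(range B)))"
        unfolding eq[symmetric] by (subst suminf_ennreal2) (auto simp: suminf_nonneg)
      ultimately have "(\<lambda>i. enn2real (total_variation m (B i))) sums enn2real (total_variation m (\<Union>(range B)))"
        by (simp add: sums_iff)
      from sums_divide[OF sums_add[OF this sums_mult[OF borel_additiveD[OF m P], of c]], of 2]
      show "(\<Sum>i. ennreal ((enn2real (total_variation m (B i)) + c * m (B i)) / 2)) =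
          ennreal ((enn2real (total_variation m (\<Union>(range B))) + c * m (\<Union>(range B))) / 2)"
        by (intro suminf_ennreal_eq nonneg Bm)
    qed
    show "A \<in> sets borel" by fact
  qed
qed

lemma
  fixes m :: "'a::topological_space set \<Rightarrow> real"
  assumes m: "borel_additive m" and fin: "total_variation m UNIV < \<infinity>"
  shows finite_measure_pos_part: "finite_measure (pos_part m)"
    and finite_measure_neg_part: "finite_measure (neg_part m)"
    and measure_pos_neg_part: "A \<in> sets borel \<Longrightarrow> measure (pos_part m) A - measure (neg_part m) A = m A"
proof -
  have "pos_part m = measure_of UNIV (sets borel) (\<lambda>A. ennreal ((enn2real (total_variation m A) + 1 * m A) / 2))"
    by (simp add: pos_part_def)
  note p = jordan_part_measure[OF m fin _ this]
  have "neg_part m = measure_of UNIV (sets borel) (\<lambda>A. ennreal ((enn2real (total_variation m A) + (- 1) * m A) / 2))"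
    by (simp add: neg_part_def)
  note n = jordan_part_measure[OF m fin _ this]
  have sp: "space (pos_part m) = UNIV" "space (neg_part m) = UNIV"
    by (simp_all add: pos_part_def neg_part_def space_measure_of_conv)
  show "finite_measure (pos_part m)"
    by (rule finite_measureI) (simp add: sp p(1)[of UNIV])
  show "finite_measure (neg_part m)"
    by (rule finite_measureI) (simp add: sp n(1)[of UNIV])
  show "measure (pos_part m) A - measure (neg_part m) A = m A" if "A \<in> sets borel"
    using p[OF _ that] n[OF _ that] by (simp add: measure_def field_simps)
qed

section \<open>Integrals as limits of averages over superlevel sets\<close>

text \<open>A discrete layer-cake formula: the sum counts the i with i \<le> k v and thus equals the
  floor of k v. Starting at i = 1 leaves out level 0, whose superlevel set for a nonnegative
  function is the whole space; the sets that remain lie where the function is positive.\<close>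

lemma level_average_bounds:
  fixes v :: real and k :: nat
  assumes "0 \<le> v" "v \<le> 1" "k > 0"
  shows "\<bar>v - (\<Sum>i=1..k. indicator {s. real i / real k \<le> s} v) / real k\<bar> \<le> 1 / real k"
proof -
  define N where "N = nat \<lfloor>real k * v\<rfloor>"
  have N: "real N \<le> real k * v" "real k * v < real N + 1" using assms by (simp_all add: N_def)
  have "real k * v \<le> real k" using assms by (simp add: mult_left_le)
  then have Nk: "N \<le> k" using N(1) by linarith
  have "(\<Sum>i=1..k. indicator {s. real i / real k \<le> s} v) = (\<Sum>i=1..k. if i \<le> N then 1 else (0::real))"
  proof (intro sum.cong refl)
    fix i assume "i \<in> {1..k}"
    have "real i / real k \<le> v \<longleftrightarrow> real i \<le> real k * v" using assms by (simp add: field_simps)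
    also have "\<dots> \<longleftrightarrow> i \<le> N" using N by linarith
    finally show "indicator {s. real i / real k \<le> s} v = (if i \<le> N then 1 else (0::real))" by simp
  qed
  also have "\<dots> = real (card ({1..k} \<inter> {i. i \<le> N}))" by (simp add: sum.If_cases)
  also have "{1..k} \<inter> {i. i \<le> N} = {1..N}" using Nk by auto
  finally have "(\<Sum>i=1..k. indicator {s. real i / real k \<le> s} v) = real N" by simp
  then have "v - (\<Sum>i=1..k. indicator {s. real i / real k \<le> s} v) / real k = (real k * v - real N) / real k"
    using assms by (simp add: field_simps)
  moreover have "\<bar>(real k * v - real N) / real k\<bar> \<le> 1 / real k"
    using N unfolding abs_divide by (simp add: divide_right_mono)
  ultimately show ?thesis by simp
qed

text \<open>The averages converge to u uniformly, at rate 1/k, so on a finite measure the integrals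
  converge at the same rate.\<close>

lemma integral_level_average_limit:
  fixes u :: "'a::topological_space \<Rightarrow> real"
  assumes "finite_measure N" and N: "sets N = sets borel"
    and u: "u \<in> borel_measurable borel" "\<And>x. 0 \<le> u x" "\<And>x. u x \<le> 1"
  shows "(\<lambda>k. (\<Sum>i=1..Suc k. measure N {x. real i / real (Suc k) \<le> u x}) / real (Suc k))
    \<longlonglongrightarrow> (LINT x|N. u x)"
proof -
  interpret finite_measure N by fact
  have sp: "space N = UNIV" using sets_eq_imp_space_eq[OF N] by simp
  have [measurable]: "u \<in> borel_measurable N" using u(1) N by (simp cong: measurable_cong_sets)
  have int_u: "integrable N u" using u by (intro integrable_const_bound[of _ 1]) auto
  have lev[measurable]: "{x. c \<le> u x} \<in> sets N" for c
    using measurable_sets[OF u(1), of "{c..}"] by (simp add: vimage_def N)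
  define w where "w k x = (\<Sum>i=1..Suc k. indicator {x. real i / real (Suc k) \<le> u x} x) / real (Suc k)" for k x
  have int_w: "integrable N (w k)" for k
    unfolding w_def using lev by (intro integrable_divide integrable_sum integrable_real_indicator) (auto simp: less_top[symmetric])
  have w_eq: "(LINT x|N. w k x) = (\<Sum>i=1..Suc k. measure N {x. real i / real (Suc k) \<le> u x}) / real (Suc k)" for k
    unfolding w_def integral_divide_zero
    by (subst Bochner_Integration.integral_sum) (auto simp: sp less_top[symmetric] intro!: integrable_real_indicator)
  have bd: "\<bar>w k x - u x\<bar> \<le> 1 / real (Suc k)" for k x
    using level_average_bounds[OF u(2,3)[of x], of "Suc k"] by (simp add: w_def indicator_def abs_minus_commute)
  have "norm ((LINT x|N. w k x) - (LINT x|N. u x)) \<le> measure N UNIV * (1 / real (Suc k))" for k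
  proof -
    have "norm ((LINT x|N. w k x) - (LINT x|N. u x)) = \<bar>LINT x|N. w k x - u x\<bar>"
      using int_w int_u by simp
    also have "\<dots> \<le> (LINT x|N. \<bar>w k x - u x\<bar>)" by (rule integral_abs_bound)
    also have "\<dots> \<le> (LINT x|N. 1 / real (Suc k))"
      using int_w int_u bd by (intro integral_mono) auto
    finally show ?thesis by (simp add: sp)
  qed
  moreover have "(\<lambda>k. measure N UNIV * (1 / real (Suc k))) \<longlonglongrightarrow> 0"
    using tendsto_mult_right_zero[OF LIMSEQ_inverse_real_of_nat, of "measure N UNIV"] by (simp add: divide_inverse)
  ultimately have "(\<lambda>k. (LINT x|N. w k x) - (LINT x|N. u x)) \<longlonglongrightarrow> 0"
    by (rule Lim_null_comparison[OF always_eventually, OF allI])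
  then show ?thesis unfolding w_eq by (simp add: LIM_zero_iff)
qed

text \<open>Expresses the integral through values of m alone: at each level set the variation
  cancels in the difference of the two Jordan parts.\<close>

lemma signed_integral_level_average_limit:
  fixes u :: "'a::topological_space \<Rightarrow> real"
  assumes m: "borel_additive m" "total_variation m UNIV < \<infinity>"
    and u: "u \<in> borel_measurable borel" "\<And>x. 0 \<le> u x" "\<And>x. u x \<le> 1"
  shows "(\<lambda>k. (\<Sum>i=1..Suc k. m {x. real i / real (Suc k) \<le> u x}) / real (Suc k))
    \<longlonglongrightarrow> signed_integral m u"
proof -
  have lev: "{x. c \<le> u x} \<in> sets borel" for c
    using measurable_sets[OF u(1), of "{c..}"] by (simp add: vimage_def)
  have "sets (pos_part m) = sets borel" "sets (neg_part m) = sets borel"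
    using sets.sigma_sets_eq[of "borel :: 'a measure"] by (simp_all add: pos_part_def neg_part_def)
  from tendsto_diff[OF integral_level_average_limit[OF finite_measure_pos_part[OF m] this(1) u]
      integral_level_average_limit[OF finite_measure_neg_part[OF m] this(2) u]]
  show ?thesis
    unfolding signed_integral_def diff_divide_distrib[symmetric] sum_subtractf[symmetric]
      measure_pos_neg_part[OF m lev] .
qed

lemma average_bound:
  fixes a :: "nat \<Rightarrow> real"
  assumes "\<And>i. i \<ge> 1 \<Longrightarrow> \<bar>a i\<bar> \<le> c"
  shows "\<bar>(\<Sum>i=1..Suc n. a i) / real (Suc n)\<bar> \<le> c"
proof -
  have "\<bar>\<Sum>i=1..Suc n. a i\<bar> \<le> (\<Sum>i=1..Suc n. \<bar>a i\<bar>)" by (rule sum_abs)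
  also have "\<dots> \<le> (\<Sum>i=1..Suc n. c)" by (rule sum_mono) (use assms in simp)
  also have "\<dots> = c * real (Suc n)" by simp
  finally show ?thesis unfolding abs_divide by (simp del: sum.cl_ivl_Suc of_nat_Suc add: pos_divide_le_eq)
qed

lemma signed_integral_cmult: "signed_integral m (\<lambda>x. g x * c) = signed_integral m g * c"
  by (simp add: signed_integral_def left_diff_distrib)

text \<open>Averaging the level sets of \<open>u\<close> avoids any polar decomposition of \<open>D\<close>.\<close>

lemma vector_integral_le_total_variation:
  fixes D :: "'a::euclidean_space set \<Rightarrow> 'b::euclidean_space" and u :: "'a \<Rightarrow> real"
  assumes D: "finite_radon_measure D" and H: "H \<in> sets borel" and \<nu>: "norm \<nu> \<le> 1"
    and u: "u \<in> borel_measurable borel" "\<And>x. 0 \<le> u x" "\<And>x. u x \<le> 1" "\<And>x. x \<notin> H \<Longrightarrow> u x = 0"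
  shows "\<bar>vector_integral D (\<lambda>x. u x *\<^sub>R \<nu>)\<bar> \<le> enn2real (total_variation D H)"
proof -
  have add: "borel_additive D" and fin: "total_variation D UNIV < \<infinity>"
    using D by (simp_all add: finite_radon_measure_def borel_additive_def)
  have m: "borel_additive (\<lambda>A. D A \<bullet> b)" "total_variation (\<lambda>A. D A \<bullet> b) UNIV < \<infinity>" if b: "b \<in> Basis" for b
  proof -
    show "borel_additive (\<lambda>A. D A \<bullet> b)"
      unfolding borel_additive_def
    proof (intro allI impI)
      fix A :: "nat \<Rightarrow> 'a set" assume "range A \<subseteq> sets borel" "disjoint_family A"
      then have "(\<lambda>i. D (A i)) sums D (\<Union>i. A i)" using add by (simp add: borel_additive_def)
      then show "(\<lambda>i. D (A i) \<bullet> b) sums (D (\<Union>i. A i) \<bullet> b)"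
        by (rule bounded_linear.sums[OF bounded_linear_inner_left])
    qed
    have "ennreal \<bar>D A \<bullet> b\<bar> \<le> ennreal (norm (D A))" for A
      using Basis_le_norm[OF b] by (intro ennreal_leI) simp
    then have "(\<Sum>i. ennreal (norm (D (P i) \<bullet> b))) \<le> (\<Sum>i. ennreal (norm (D (P i))))" for P :: "nat \<Rightarrow> 'a set"
      by (intro suminf_le) auto
    then have "total_variation (\<lambda>A. D A \<bullet> b) UNIV \<le> total_variation D UNIV"
      unfolding total_variation_eq by (intro SUP_mono) blast
    then show "total_variation (\<lambda>A. D A \<bullet> b) UNIV < \<infinity>" using fin by (rule le_less_trans)
  qed
  define L where "L k i = {x. real i / real (Suc k) \<le> u x}" for k i :: nat
  have Lm: "L k i \<in> sets borel" for k i
    using measurable_sets[OF u(1), of "{real i / real (Suc k)..}"] by (simp add: vimage_def L_def)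
  have LH: "L k i \<subseteq> H" if "i \<ge> 1" for k i
  proof
    fix x assume "x \<in> L k i"
    then have "real i / real (Suc k) \<le> u x" by (simp add: L_def)
    moreover have "0 < real i / real (Suc k)" using that by (intro divide_pos_pos) auto
    ultimately have "u x \<noteq> 0" by linarith
    then show "x \<in> H" using u(4) by blast
  qed
  have T: "total_variation D H < \<infinity>" using total_variation_mono[OF H, of UNIV D] fin by (simp add: le_less_trans)
  \<comment> \<open>For i \<ge> 1 the level set is contained in H, so its D-measure is a single
    value, bounded in norm by the variation on H.\<close>
  have le: "\<bar>D (L k i) \<bullet> \<nu>\<bar> \<le> enn2real (total_variation D H)" if "i \<ge> 1" for k i
  proof -
    have "ennreal (norm (D (L k i))) \<le> ennreal (enn2real (total_variation D H))"
      using norm_le_total_variation[OF add Lm H LH[OF that]] T by simp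
    then have "norm (D (L k i)) \<le> enn2real (total_variation D H)" by (subst (asm) ennreal_le_iff) auto
    moreover have "\<bar>D (L k i) \<bullet> \<nu>\<bar> \<le> norm (D (L k i)) * norm \<nu>" by (rule Cauchy_Schwarz_ineq2)
    moreover have "norm (D (L k i)) * norm \<nu> \<le> norm (D (L k i))" using \<nu> by (simp add: mult_left_le)
    ultimately show ?thesis by linarith
  qed
  have 1: "(\<lambda>k. \<Sum>b\<in>Basis. ((\<Sum>i=1..Suc k. D (L k i) \<bullet> b) / real (Suc k)) * (\<nu> \<bullet> b))
      \<longlonglongrightarrow> (\<Sum>b\<in>Basis. signed_integral (\<lambda>A. D A \<bullet> b) u * (\<nu> \<bullet> b))"
    unfolding L_def
    by (rule tendsto_sum) (rule tendsto_mult_right, rule signed_integral_level_average_limit[OF m u(1-3)])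
  \<comment> \<open>The components are recombined into D(L) . \<nu> before anything is estimated;
    bounding them one at a time would cost a dimensional factor.\<close>
  have 2: "(\<Sum>b\<in>Basis. ((\<Sum>i=1..Suc k. D (L k i) \<bullet> b) / real (Suc k)) * (\<nu> \<bullet> b))
     = (\<Sum>i=1..Suc k. D (L k i) \<bullet> \<nu>) / real (Suc k)" for k
  proof -
    have "(\<Sum>i=1..Suc k. D (L k i) \<bullet> \<nu>) = (\<Sum>i=1..Suc k. \<Sum>b\<in>Basis. (D (L k i) \<bullet> b) * (\<nu> \<bullet> b))"
      by (rule sum.cong[OF refl]) (rule euclidean_inner)
    also have "\<dots> = (\<Sum>b\<in>Basis. \<Sum>i=1..Suc k. (D (L k i) \<bullet> b) * (\<nu> \<bullet> b))" by (rule sum.swap)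
    finally show ?thesis
      by (simp only: sum_distrib_right sum_divide_distrib times_divide_eq_left)
  qed
  have 3: "(\<Sum>b\<in>Basis. signed_integral (\<lambda>A. D A \<bullet> b) u * (\<nu> \<bullet> b)) = vector_integral D (\<lambda>x. u x *\<^sub>R \<nu>)"
    by (simp add: vector_integral_def signed_integral_cmult)
  have lim: "(\<lambda>k. \<bar>(\<Sum>i=1..Suc k. D (L k i) \<bullet> \<nu>) / real (Suc k)\<bar>) \<longlonglongrightarrow> \<bar>vector_integral D (\<lambda>x. u x *\<^sub>R \<nu>)\<bar>"
    by (rule tendsto_rabs[OF 1[unfolded 2 3]])
  show ?thesis
    by (rule LIMSEQ_le_const2[OF lim], rule exI[of _ 0], intro allI impI, rule average_bound, erule le)
qed

section \<open>Testing with half-spaces\<close>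

text \<open>The value 0 at 0 makes it the pointwise limit of the ramps everywhere and its
  composition with (y - x0) . \<nu> the indicator of the open half-space.\<close>

definition heaviside :: "real \<Rightarrow> real" where
  "heaviside s = (if s > 0 then 1 else 0)"

lemma borel_measurable_heaviside[measurable]: "heaviside \<in> borel_measurable borel"
  unfolding heaviside_def[abs_def] by measurable

text \<open>The increment is nonzero only if t and t + s lie on different sides of 0, and then it
  has the sign of s. What remains is |s|^(-1-\<alpha>) on a half-line at distance |t| from 0; it
  points to the left if t > 0 and to the right if t < 0.\<close>

lemma nn_integral_heaviside_gradient:
  assumes \<alpha>: "\<alpha> > 0" and t: "t \<noteq> 0"
  shows "(\<integral>\<^sup>+s. ennreal (s * (heaviside (t + s) - heaviside t) * \<bar>s\<bar> powr (- 2 - \<alpha>)) \<partial>lborel)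
    = ennreal (\<bar>t\<bar> powr (- \<alpha>) / \<alpha>)"
proof -
  define g where "g = (\<lambda>s. ennreal (s powr (- 1 - \<alpha>)) * indicator {\<bar>t\<bar>..} s)"
  have [measurable]: "g \<in> borel_measurable borel" unfolding g_def by measurable
  have g: "(\<integral>\<^sup>+s. g s \<partial>lborel) = ennreal (\<bar>t\<bar> powr (- \<alpha>) / \<alpha>)"
    unfolding g_def using \<alpha> t by (intro nn_integral_powr_Ici) auto
  have base: "s * s powr (- 2 - \<alpha>) = s powr (- 1 - \<alpha>)" if "s \<ge> 0" for s :: real
    using powr_mult_base[OF that, of "- 2 - \<alpha>"] by simp
  show ?thesis
  proof (cases "t > 0")
    case True
    have "ennreal (s * (heaviside (t + s) - heaviside t) * \<bar>s\<bar> powr (- 2 - \<alpha>)) = g (- s)" for s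
    proof (cases "s \<le> - t")
      case s: True
      have "s * (heaviside (t + s) - heaviside t) * \<bar>s\<bar> powr (- 2 - \<alpha>) = (- s) * (- s) powr (- 2 - \<alpha>)"
        using True s by (simp add: heaviside_def)
      also have "\<dots> = (- s) powr (- 1 - \<alpha>)" using True s by (intro base) simp
      finally show ?thesis using True s by (simp add: g_def)
    next
      case False
      then show ?thesis using True by (simp add: g_def heaviside_def)
    qed
    then show ?thesis using nn_integral_lborel_reflect[of g] g by simp
  next
    case False
    \<comment> \<open>At \<open>s = - t\<close> the left-hand side is 0 because
      \<open>heaviside 0 = 0\<close>, while \<open>g\<close> is positive. For positive t the
      endpoint agrees; here it is discarded as a null set.\<close>
    have "ennreal (s * (heaviside (t + s) - heaviside t) * \<bar>s\<bar> powr (- 2 - \<alpha>)) = g s" if "s \<noteq> - t" for s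
    proof (cases "s > - t")
      case s: True
      then have "s * (heaviside (t + s) - heaviside t) * \<bar>s\<bar> powr (- 2 - \<alpha>) = s * s powr (- 2 - \<alpha>)"
        using False t by (simp add: heaviside_def)
      also have "\<dots> = s powr (- 1 - \<alpha>)" using False s by (intro base) simp
      finally show ?thesis using False t s by (simp add: g_def)
    next
      case s: False
      then show ?thesis using False that t by (simp add: g_def heaviside_def)
    qed
    then have "(\<integral>\<^sup>+s. ennreal (s * (heaviside (t + s) - heaviside t) * \<bar>s\<bar> powr (- 2 - \<alpha>)) \<partial>lborel) = (\<integral>\<^sup>+s. g s \<partial>lborel)"
      by (intro nn_integral_cong_AE eventually_mono[OF AE_lborel_singleton[of "- t"]])
    then show ?thesis using g by simp
  qed
qed

lemma frac_const_pos: "0 < \<alpha> \<Longrightarrow> \<alpha> < 1 \<Longrightarrow> frac_const n \<alpha> > 0"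
  unfolding frac_const_def by (intro mult_pos_pos divide_pos_pos Gamma_real_pos) auto

text \<open>The pointwise form of the divergence formula for the half-space field, off its boundary
  hyperplane. Slicing reduces it to \<open>nn_integral_heaviside_gradient\<close>, and the slicing
  constant is precisely the quotient of the fractional constants in dimensions 1 and n.\<close>

lemma nn_integral_half_space_gradient:
  fixes x x0 \<nu> :: "real ^ 'n"
  assumes \<alpha>: "0 < \<alpha>" "\<alpha> < 1" and \<nu>: "norm \<nu> = 1" and x: "(x - x0) \<bullet> \<nu> \<noteq> 0"
  shows "ennreal (frac_const CARD('n) \<alpha>) *
      (\<integral>\<^sup>+y. ennreal ((y - x) \<bullet> \<nu> * (heaviside ((y - x0) \<bullet> \<nu>) - heaviside ((x - x0) \<bullet> \<nu>))
        / norm (y - x) powr (real CARD('n) + \<alpha> + 1)) \<partial>lborel)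
    = ennreal (frac_const 1 \<alpha> / \<alpha> * \<bar>(x - x0) \<bullet> \<nu>\<bar> powr (- \<alpha>))"
proof -
  define t where "t = (x - x0) \<bullet> \<nu>"
  define h where "h s = s * (heaviside (t + s) - heaviside t)" for s
  have [measurable]: "h \<in> borel_measurable borel" unfolding h_def[abs_def] by measurable
  have h: "h s \<ge> 0" for s by (simp add: h_def heaviside_def)
  \<comment> \<open>The extra 1 in the exponent balances the factor s in \<open>h\<close>; slicing
    leaves -2 - \<alpha> on the line.\<close>
  define a where "a = (real CARD('n) + \<alpha> + 1) / 2"
  define c where "c = pi powr ((real CARD('n) - 1) / 2) * Gamma (a - (real CARD('n) - 1) / 2) / Gamma a"
  have a2: "- 2 * a = - (real CARD('n) + \<alpha> + 1)" by (simp add: a_def)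
  have a: "2 * a > real CARD('n) - 1" "a > 0" "a - (real CARD('n) - 1) / 2 = (\<alpha> + 2) / 2"
    using \<alpha> by (simp_all add: a_def field_simps)
  have "(\<integral>\<^sup>+y. ennreal ((y - x) \<bullet> \<nu> * (heaviside ((y - x0) \<bullet> \<nu>) - heaviside ((x - x0) \<bullet> \<nu>))
        / norm (y - x) powr (real CARD('n) + \<alpha> + 1)) \<partial>lborel)
    = (\<integral>\<^sup>+y. ennreal (h ((y - x) \<bullet> \<nu>) * norm (y - x) powr (- 2 * a)) \<partial>lborel)"
  proof (rule nn_integral_cong)
    fix y
    have "(y - x0) \<bullet> \<nu> = t + (y - x) \<bullet> \<nu>" by (simp add: t_def inner_diff_left)
    moreover have "norm (y - x) powr (- 2 * a) = 1 / norm (y - x) powr (real CARD('n) + \<alpha> + 1)"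
      unfolding a2 by (rule powr_minus_divide)
    ultimately show "ennreal ((y - x) \<bullet> \<nu> * (heaviside ((y - x0) \<bullet> \<nu>) - heaviside ((x - x0) \<bullet> \<nu>))
        / norm (y - x) powr (real CARD('n) + \<alpha> + 1)) = ennreal (h ((y - x) \<bullet> \<nu>) * norm (y - x) powr (- 2 * a))"
      by (simp add: h_def t_def)
  qed
  also have "\<dots> = (\<integral>\<^sup>+w. ennreal (h (w \<bullet> \<nu>) * norm w powr (- 2 * a)) \<partial>lborel)"
    using nn_integral_lborel_shift[of "\<lambda>w. ennreal (h (w \<bullet> \<nu>) * norm w powr (- 2 * a))" "- x"] by simp
  also have "\<dots> = ennreal c * (\<integral>\<^sup>+s. ennreal (h s * \<bar>s\<bar> powr (real CARD('n) - 1 - 2 * a)) \<partial>lborel)"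
    unfolding c_def by (rule nn_integral_powr_slice[OF _ h \<nu> a(1)]) measurable
  also have "real CARD('n) - 1 - 2 * a = - 2 - \<alpha>" by (simp add: a_def field_simps)
  also have "(\<integral>\<^sup>+s. ennreal (h s * \<bar>s\<bar> powr (- 2 - \<alpha>)) \<partial>lborel) = ennreal (\<bar>t\<bar> powr (- \<alpha>) / \<alpha>)"
    unfolding h_def using x \<alpha> by (intro nn_integral_heaviside_gradient) (simp_all add: t_def)
  finally have 1: "(\<integral>\<^sup>+y. ennreal ((y - x) \<bullet> \<nu> * (heaviside ((y - x0) \<bullet> \<nu>) - heaviside ((x - x0) \<bullet> \<nu>))
        / norm (y - x) powr (real CARD('n) + \<alpha> + 1)) \<partial>lborel) = ennreal c * ennreal (\<bar>t\<bar> powr (- \<alpha>) / \<alpha>)" .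
  have G: "Gamma a > 0" using a by simp
  \<comment> \<open>\<open>Gamma a\<close> cancels, and the powers of pi combine to the exponent
    -1/2. The Gamma value left over belongs to dimension 1, and the other two factors do not depend
    on the dimension.\<close>
  have "frac_const CARD('n) \<alpha> * c = frac_const 1 \<alpha>"
  proof -
    have "frac_const CARD('n) \<alpha> * c = 2 powr \<alpha> * (pi powr (- real CARD('n) / 2) * pi powr ((real CARD('n) - 1) / 2))
        * (Gamma a / Gamma a) * Gamma ((\<alpha> + 2) / 2) / Gamma ((1 - \<alpha>) / 2)"
      unfolding frac_const_def c_def a(3) a_def[symmetric] by (simp add: mult_ac)
    also have "pi powr (- real CARD('n) / 2) * pi powr ((real CARD('n) - 1) / 2) = pi powr (- real 1 / 2)"
      unfolding powr_add[symmetric] by (simp add: field_simps)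
    also have "(\<alpha> + 2) / 2 = (real 1 + \<alpha> + 1) / 2" by simp
    finally show ?thesis using G by (simp add: frac_const_def)
  qed
  moreover have "c > 0" using \<alpha> a(2) unfolding c_def a(3) by (intro mult_pos_pos divide_pos_pos Gamma_real_pos) auto
  ultimately show ?thesis
    unfolding 1 unfolding t_def[symmetric] using \<alpha> frac_const_pos[OF \<alpha>, of "CARD('n)"]
    by (simp add: ennreal_mult[symmetric] mult.assoc[symmetric])
qed

section \<open>Splitting the divergence of a product test field\<close>

lemma abs_kernel_le:
  fixes x y \<nu> :: "'a::real_inner"
  assumes "norm \<nu> = 1"
  shows "\<bar>(y - x) \<bullet> \<nu> * d / norm (y - x) powr (s + 1)\<bar> \<le> \<bar>d\<bar> * norm (y - x) powr (- s)"
proof (cases "y = x")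
  case False
  define z where "z = norm (y - x)"
  have z: "z > 0" using False by (simp add: z_def)
  have "\<bar>(y - x) \<bullet> \<nu>\<bar> \<le> z" using Cauchy_Schwarz_ineq2[of "y - x" \<nu>] assms by (simp add: z_def)
  then have "\<bar>(y - x) \<bullet> \<nu>\<bar> * \<bar>d\<bar> / z powr (s + 1) \<le> z * \<bar>d\<bar> / z powr (s + 1)"
    by (intro divide_right_mono mult_right_mono) auto
  also have "\<dots> = \<bar>d\<bar> * z powr (- s)" using z by (simp add: powr_add powr_minus divide_simps)
  finally show ?thesis by (simp add: z_def abs_mult abs_divide)
qed simp

lemma abs_mult_diff_le:
  fixes a b c d :: real
  assumes "0 \<le> a" "a \<le> 1" "0 \<le> d" "d \<le> 1"
  shows "\<bar>a * b - c * d\<bar> \<le> \<bar>a - c\<bar> + \<bar>b - d\<bar>"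
proof -
  have "a * b - c * d = d * (a - c) + a * (b - d)" by (simp add: algebra_simps)
  then have "\<bar>a * b - c * d\<bar> \<le> \<bar>d * (a - c)\<bar> + \<bar>a * (b - d)\<bar>" by (simp only: abs_triangle_ineq)
  also have "\<dots> \<le> \<bar>a - c\<bar> + \<bar>b - d\<bar>"
    using assms by (intro add_mono) (auto simp: abs_mult intro!: mult_left_le_one_le)
  finally show ?thesis .
qed

text \<open>Meant for an \<open>a\<close> of unknown sign, namely the integral of \<open>f\<close>
  against a fractional divergence: if a < 0, truncation only helps.\<close>

lemma ennreal_add_le:
  assumes "b \<ge> 0" shows "ennreal (a + b) \<le> ennreal a + ennreal b"
proof (cases "a \<ge> 0")
  case False
  then have "ennreal (a + b) \<le> ennreal b" by (intro ennreal_leI) simp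
  then show ?thesis by (simp add: add_increasing)
qed (use assms in simp)

text \<open>Cauchy-Schwarz absorbs one power of the norm, which leaves the kernel of
  \<open>nonlocal_gradient\<close>. Here \<open>d\<close> is either the increment of
  \<open>v\<close> itself or that increment damped by a factor between 0 and 1, as in a Leibniz
  rule.\<close>

lemma integrable_kernel:
  fixes u v :: "real ^ 'n \<Rightarrow> real"
  assumes \<nu>: "norm \<nu> = 1" and [measurable]: "v \<in> borel_measurable borel" "d \<in> borel_measurable borel"
    and fin: "nonlocal_gradient \<alpha> v x < \<infinity>" and d: "\<And>y. \<bar>d y\<bar> \<le> \<bar>v y - v x\<bar>"
  shows "integrable lborel (\<lambda>y. (y - x) \<bullet> \<nu> * d y / norm (y - x) powr (real CARD('n) + \<alpha> + 1))" (is "integrable _ ?q")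
    and "ennreal \<bar>LINT y|lborel. (y - x) \<bullet> \<nu> * d y / norm (y - x) powr (real CARD('n) + \<alpha> + 1)\<bar> \<le> nonlocal_gradient \<alpha> v x"
proof -
  have le: "(\<integral>\<^sup>+y. ennreal (norm (?q y)) \<partial>lborel) \<le> nonlocal_gradient \<alpha> v x"
    unfolding nonlocal_gradient_def
  proof (intro nn_integral_mono ennreal_leI)
    fix y
    have "norm (?q y) \<le> \<bar>d y\<bar> * norm (y - x) powr (- (real CARD('n) + \<alpha>))"
      using abs_kernel_le[OF \<nu>, of y x "d y" "real CARD('n) + \<alpha>"] by simp
    also have "\<dots> \<le> \<bar>v y - v x\<bar> * norm (y - x) powr (- (real CARD('n) + \<alpha>))"
      using d by (intro mult_right_mono) auto
    finally show "norm (?q y) \<le> \<bar>v y - v x\<bar> * norm (y - x) powr (- (real CARD('n) + \<alpha>))" .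
  qed
  show int: "integrable lborel ?q"
    using le_less_trans[OF le fin] by (intro integrableI_bounded) auto
  show "ennreal \<bar>LINT y|lborel. ?q y\<bar> \<le> nonlocal_gradient \<alpha> v x"
    using order_trans[OF integral_norm_bound_ennreal[OF int] le] by simp
qed

text \<open>Testing with \<open>\<phi> = g \<eta> \<nu>\<close>, where \<open>g\<close> is nondecreasing in the direction \<open>\<nu>\<close>: up to an error
  controlled by the nonlocal gradient of \<open>\<eta>\<close>, the fractional divergence is \<open>\<eta>\<close> times the
  nonnegative integral on the left-hand side.\<close>

lemma monotone_test_field_le:
  fixes f :: "real ^ 'n \<Rightarrow> real" and g \<eta> :: "real ^ 'n \<Rightarrow> real"
  assumes \<alpha>: "0 < \<alpha>" "\<alpha> < 1" and p: "1 \<le> p" and f: "f \<in> Lp p" and fpos: "AE x in lebesgue. f x \<ge> 0"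
    and \<nu>: "norm \<nu> = 1"
    and gm[measurable]: "g \<in> borel_measurable borel" and g: "\<And>y. 0 \<le> g y" "\<And>y. g y \<le> 1"
    and r: "r > 0" and g_lip: "\<And>x y. \<bar>g y - g x\<bar> \<le> min 1 (norm (y - x) / r)"
    and g_mono: "\<And>x y. (y - x) \<bullet> \<nu> * (g y - g x) \<ge> 0"
    and \<eta>m[measurable]: "\<eta> \<in> borel_measurable borel" and \<eta>: "\<And>y. 0 \<le> \<eta> y" "\<And>y. \<eta> y \<le> 1"
    and R: "R > 0" and \<eta>_lip: "\<And>x y. \<bar>\<eta> y - \<eta> x\<bar> \<le> min 1 (norm (y - x) / R)"
    and S: "S \<in> sets borel" "emeasure lborel S < \<infinity>" "\<And>x. x \<notin> S \<Longrightarrow> \<eta> x = 0"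
  shows "(\<integral>\<^sup>+x. ennreal (f x * frac_const CARD('n) \<alpha> * \<eta> x) *
      (\<integral>\<^sup>+y. ennreal ((y - x) \<bullet> \<nu> * (g y - g x) / norm (y - x) powr (real CARD('n) + \<alpha> + 1)) \<partial>lborel) \<partial>lebesgue)
    \<le> ennreal (LINT x|lebesgue. f x * frac_div \<alpha> (\<lambda>y. (g y * \<eta> y) *\<^sub>R \<nu>) x)
      + ennreal (frac_const CARD('n) \<alpha>) * (\<integral>\<^sup>+x. ennreal \<bar>f x\<bar> * nonlocal_gradient \<alpha> \<eta> x \<partial>lebesgue)"
proof -
  define \<mu> where "\<mu> = frac_const CARD('n) \<alpha>"
  have \<mu>: "\<mu> > 0" unfolding \<mu>_def by (rule frac_const_pos[OF \<alpha>])
  define u where "u = (\<lambda>y. g y * \<eta> y)"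
  have um[measurable]: "u \<in> borel_measurable borel" unfolding u_def by measurable
  have fm[measurable]: "f \<in> borel_measurable lebesgue" using f by (simp add: Lp_def)
  \<comment> \<open>1/\<rho> is the sum of the Lipschitz constants of the two factors. It grows with
    the slope of \<open>g\<close>, which is harmless because only the finiteness of the integrals of
    \<open>u\<close> is drawn from it.\<close>
  define \<rho> where "\<rho> = 1 / (1 / r + 1 / R)"
  have \<rho>: "\<rho> > 0" using r R by (simp add: \<rho>_def add_pos_pos)
  have u_lip: "\<bar>u y - u x\<bar> \<le> min 1 (norm (y - x) / \<rho>)" for x y
  proof -
    have "\<bar>u y - u x\<bar> \<le> 1"
    proof -
      have "0 \<le> u z" "u z \<le> 1" for z using g \<eta> by (auto simp: u_def mult_le_one)
      from this[of x] this[of y] show ?thesis by linarith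
    qed
    moreover have "\<bar>u y - u x\<bar> \<le> norm (y - x) / \<rho>"
    proof -
      have "\<bar>u y - u x\<bar> \<le> \<bar>g y - g x\<bar> + \<bar>\<eta> y - \<eta> x\<bar>"
        unfolding u_def by (rule abs_mult_diff_le[OF g \<eta>])
      also have "\<dots> \<le> norm (y - x) / r + norm (y - x) / R" using g_lip[of y x] \<eta>_lip[of y x] by linarith
      also have "\<dots> = norm (y - x) / \<rho>" by (simp add: \<rho>_def distrib_left)
      finally show ?thesis .
    qed
    ultimately show ?thesis by simp
  qed
  have u0: "u x = 0" if "x \<notin> S" for x using S(3)[OF that] by (simp add: u_def)
  have ng_fin: "nonlocal_gradient \<alpha> v x < \<infinity>"
    if "v \<in> borel_measurable borel" "\<rho>' > 0" "\<And>x y. \<bar>v y - v x\<bar> \<le> min 1 (norm (y - x) / \<rho>')"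
    for v :: "real ^ 'n \<Rightarrow> real" and \<rho>' x
  proof (rule nonlocal_gradient_bounds[OF \<alpha>, where 'n = 'n])
    fix C :: real
    assume "\<And>(u :: real^'n \<Rightarrow> real) r x. r > 0 \<Longrightarrow> u \<in> borel_measurable borel \<Longrightarrow>
        (\<And>x y. \<bar>u y - u x\<bar> \<le> min 1 (norm (y - x) / r)) \<Longrightarrow>
        nonlocal_gradient \<alpha> u x \<le> ennreal (C * r powr (- \<alpha>))"
    from this[OF that(2,1,3), of x] show ?thesis by (simp add: le_less_trans)
  qed
  have g_fin: "nonlocal_gradient \<alpha> g x < \<infinity>" for x by (rule ng_fin[OF gm r g_lip])
  have \<eta>_fin: "nonlocal_gradient \<alpha> \<eta> x < \<infinity>" for x by (rule ng_fin[OF \<eta>m R \<eta>_lip])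
  have u_fin: "nonlocal_gradient \<alpha> u x < \<infinity>" for x by (rule ng_fin[OF um \<rho> u_lip])

  let ?N = "\<lambda>x y. norm (y - x) powr (real CARD('n) + \<alpha> + 1)"
  define q where "q x y = (y - x) \<bullet> \<nu> * (g y - g x) / ?N x y" for x y
  define J where "J x = (LINT y|lborel. q x y)" for x
  define Q where "Q x = (LINT y|lborel. (y - x) \<bullet> \<nu> * (g y * (\<eta> y - \<eta> x)) / ?N x y)" for x
  define U where "U x = (LINT y|lborel. (y - x) \<bullet> \<nu> * (u y - u x) / ?N x y)" for x
  have q_int: "integrable lborel (q x)" for x
    unfolding q_def using g_fin by (intro integrable_kernel(1)[OF \<nu> gm]) auto
  have Q_int: "integrable lborel (\<lambda>y. (y - x) \<bullet> \<nu> * (g y * (\<eta> y - \<eta> x)) / ?N x y)" for x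
    using \<eta>_fin g by (intro integrable_kernel(1)[OF \<nu> \<eta>m]) (auto simp: abs_mult intro!: mult_left_le_one_le)
  have Q_le: "ennreal \<bar>Q x\<bar> \<le> nonlocal_gradient \<alpha> \<eta> x" for x
    unfolding Q_def using \<eta>_fin g
    by (intro integrable_kernel(2)[OF \<nu> \<eta>m]) (auto simp: abs_mult intro!: mult_left_le_one_le)
  have U_le: "ennreal \<bar>U x\<bar> \<le> nonlocal_gradient \<alpha> u x" for x
    unfolding U_def using u_fin by (intro integrable_kernel(2)[OF \<nu> um]) auto
  have [measurable]: "J \<in> borel_measurable borel" "Q \<in> borel_measurable borel" "U \<in> borel_measurable borel"
    unfolding J_def[abs_def] Q_def[abs_def] U_def[abs_def] q_def by measurable
  have J_pos: "J x \<ge> 0" for x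
    unfolding J_def q_def using g_mono by (intro integral_nonneg_AE) auto
  have J_eq: "(\<integral>\<^sup>+y. ennreal (q x y) \<partial>lborel) = ennreal (J x)" for x
    unfolding J_def
  proof (rule nn_integral_eq_integral[OF q_int])
    show "AE y in lborel. 0 \<le> q x y" using g_mono by (simp add: q_def)
  qed
  \<comment> \<open>An asymmetric Leibniz rule: \<eta> is frozen at x beside the increment of g, and
    g is taken at y beside the increment of \<eta>. Since 0 \<le> g \<le> 1, the error
    \<open>Q\<close> is bounded through \<eta> alone, however steep g is.\<close>
  have U_eq: "U x = \<eta> x * J x + Q x" for x
  proof -
    have "U x = (LINT y|lborel. \<eta> x * q x y + (y - x) \<bullet> \<nu> * (g y * (\<eta> y - \<eta> x)) / ?N x y)"
      unfolding U_def
    proof (rule Bochner_Integration.integral_cong[OF refl])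
      fix y
      have "u y - u x = \<eta> x * (g y - g x) + g y * (\<eta> y - \<eta> x)" by (simp add: u_def algebra_simps)
      then show "(y - x) \<bullet> \<nu> * (u y - u x) / ?N x y
          = \<eta> x * q x y + (y - x) \<bullet> \<nu> * (g y * (\<eta> y - \<eta> x)) / ?N x y"
        unfolding q_def by (simp add: distrib_left add_divide_distrib)
    qed
    also have "\<dots> = \<eta> x * J x + Q x"
      unfolding J_def Q_def by (subst Bochner_Integration.integral_add) (use q_int Q_int in auto)
    finally show ?thesis .
  qed
  have div: "frac_div \<alpha> (\<lambda>y. u y *\<^sub>R \<nu>) x = \<mu> * U x" for x
  proof -
    have "(LINT y|lebesgue. (y - x) \<bullet> (u y *\<^sub>R \<nu> - u x *\<^sub>R \<nu>) / ?N x y)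
      = (LINT y|lebesgue. (y - x) \<bullet> \<nu> * (u y - u x) / ?N x y)"
      by (simp add: scaleR_left_diff_distrib[symmetric] mult.commute)
    also have "\<dots> = U x" unfolding U_def by (rule integral_completion) measurable
    finally show ?thesis by (simp add: frac_div_def \<mu>_def)
  qed
  have lebm: "h \<in> borel_measurable lebesgue" if "h \<in> borel_measurable borel" for h :: "real ^ 'n \<Rightarrow> real"
    using that by (simp add: measurable_completion)
  note [measurable] = lebm[of J] lebm[of Q] lebm[of U] lebm[OF \<eta>m]
  have int_bound: "integrable lebesgue (\<lambda>x. f x * (\<mu> * W x))"
      "(\<integral>\<^sup>+x. ennreal (norm (f x * (\<mu> * W x))) \<partial>lebesgue) \<le> ennreal \<mu> * (\<integral>\<^sup>+x. ennreal \<bar>f x\<bar> * nonlocal_gradient \<alpha> v x \<partial>lebesgue)"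
    if W: "W \<in> borel_measurable borel" "\<And>x. ennreal \<bar>W x\<bar> \<le> nonlocal_gradient \<alpha> v x"
      and v[measurable]: "v \<in> borel_measurable borel"
      and fin: "(\<integral>\<^sup>+x. ennreal \<bar>f x\<bar> * nonlocal_gradient \<alpha> v x \<partial>lebesgue) < \<infinity>" for W v
  proof -
    note [measurable] = lebm[OF W(1)]
    have [measurable]: "nonlocal_gradient \<alpha> v \<in> borel_measurable lebesgue"
      using borel_measurable_nonlocal_gradient[OF v] by (simp add: measurable_completion)
    have "(\<integral>\<^sup>+x. ennreal (norm (f x * (\<mu> * W x))) \<partial>lebesgue)
        \<le> (\<integral>\<^sup>+x. ennreal \<mu> * (ennreal \<bar>f x\<bar> * nonlocal_gradient \<alpha> v x) \<partial>lebesgue)"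
    proof (rule nn_integral_mono)
      fix x
      have "ennreal (norm (f x * (\<mu> * W x))) = ennreal \<mu> * (ennreal \<bar>f x\<bar> * ennreal \<bar>W x\<bar>)"
        using \<mu> by (simp add: abs_mult ennreal_mult[symmetric] mult_ac)
      also have "\<dots> \<le> ennreal \<mu> * (ennreal \<bar>f x\<bar> * nonlocal_gradient \<alpha> v x)"
        by (intro mult_left_mono W(2)) auto
      finally show "ennreal (norm (f x * (\<mu> * W x))) \<le> ennreal \<mu> * (ennreal \<bar>f x\<bar> * nonlocal_gradient \<alpha> v x)" .
    qed
    also have "\<dots> = ennreal \<mu> * (\<integral>\<^sup>+x. ennreal \<bar>f x\<bar> * nonlocal_gradient \<alpha> v x \<partial>lebesgue)"
      by (rule nn_integral_cmult) measurable
    finally show le: "(\<integral>\<^sup>+x. ennreal (norm (f x * (\<mu> * W x))) \<partial>lebesgue)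
        \<le> ennreal \<mu> * (\<integral>\<^sup>+x. ennreal \<bar>f x\<bar> * nonlocal_gradient \<alpha> v x \<partial>lebesgue)" .
    also have "\<dots> < \<infinity>" using fin by (simp add: ennreal_mult_less_top)
    finally show "integrable lebesgue (\<lambda>x. f x * (\<mu> * W x))" by (intro integrableI_bounded) auto
  qed
  have int_U: "integrable lebesgue (\<lambda>x. f x * (\<mu> * U x))"
    by (rule int_bound(1)[OF _ U_le um nn_integral_nonlocal_gradient_finite[OF \<alpha> p f \<rho> um u_lip S(1,2) u0]]) measurable
  have fin\<eta>: "(\<integral>\<^sup>+x. ennreal \<bar>f x\<bar> * nonlocal_gradient \<alpha> \<eta> x \<partial>lebesgue) < \<infinity>"
    by (rule nn_integral_nonlocal_gradient_finite[OF \<alpha> p f R \<eta>m \<eta>_lip S])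
  have int_Q: "integrable lebesgue (\<lambda>x. f x * (\<mu> * Q x))"
    by (rule int_bound(1)[OF _ Q_le \<eta>m fin\<eta>]) measurable
  have le_Q: "(\<integral>\<^sup>+x. ennreal (norm (f x * (\<mu> * Q x))) \<partial>lebesgue)
     \<le> ennreal \<mu> * (\<integral>\<^sup>+x. ennreal \<bar>f x\<bar> * nonlocal_gradient \<alpha> \<eta> x \<partial>lebesgue)"
    by (rule int_bound(2)[OF _ Q_le \<eta>m fin\<eta>]) measurable
  have eq: "f x * \<mu> * \<eta> x * J x = f x * (\<mu> * U x) - f x * (\<mu> * Q x)" for x
    unfolding U_eq by (simp add: algebra_simps)
  \<comment> \<open>Integrability of the main term is read off from the other two, since it is their
    difference.\<close>
  have int_J: "integrable lebesgue (\<lambda>x. f x * \<mu> * \<eta> x * J x)"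
    unfolding eq using int_U int_Q by (rule Bochner_Integration.integrable_diff)
  have "(\<integral>\<^sup>+x. ennreal (f x * \<mu> * \<eta> x) * (\<integral>\<^sup>+y. ennreal (q x y) \<partial>lborel) \<partial>lebesgue)
     = (\<integral>\<^sup>+x. ennreal (f x * \<mu> * \<eta> x * J x) \<partial>lebesgue)"
    unfolding J_eq using J_pos by (simp add: ennreal_mult'')
  also have "\<dots> = ennreal (LINT x|lebesgue. f x * \<mu> * \<eta> x * J x)"
  proof (rule nn_integral_eq_integral[OF int_J])
    show "AE x in lebesgue. 0 \<le> f x * \<mu> * \<eta> x * J x"
      using fpos by eventually_elim (use \<mu> \<eta> J_pos in auto)
  qed
  also have "(LINT x|lebesgue. f x * \<mu> * \<eta> x * J x) = (LINT x|lebesgue. f x * (\<mu> * U x)) - (LINT x|lebesgue. f x * (\<mu> * Q x))"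
    unfolding eq using int_U int_Q by (rule Bochner_Integration.integral_diff)
  also have "ennreal \<dots> \<le> ennreal ((LINT x|lebesgue. f x * (\<mu> * U x)) + norm (LINT x|lebesgue. f x * (\<mu> * Q x)))"
    by (intro ennreal_leI) simp
  also have "\<dots> \<le> ennreal (LINT x|lebesgue. f x * (\<mu> * U x)) + ennreal (norm (LINT x|lebesgue. f x * (\<mu> * Q x)))"
    by (rule ennreal_add_le) simp
  also have "\<dots> \<le> ennreal (LINT x|lebesgue. f x * (\<mu> * U x))
      + ennreal \<mu> * (\<integral>\<^sup>+x. ennreal \<bar>f x\<bar> * nonlocal_gradient \<alpha> \<eta> x \<partial>lebesgue)"
    using order_trans[OF integral_norm_bound_ennreal[OF int_Q] le_Q] by (rule add_left_mono)
  finally show ?thesis unfolding div[symmetric] unfolding u_def \<mu>_def q_def .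
qed

section \<open>Ramps, admissibility of the test fields, and the passage to the limit\<close>

definition ramp :: "real \<Rightarrow> real \<Rightarrow> real" where
  "ramp K s = min 1 (max 0 (K * s))"

lemma borel_measurable_ramp[measurable]: "ramp K \<in> borel_measurable borel"
  unfolding ramp_def[abs_def] by measurable

lemma ramp_range: "0 \<le> ramp K s" "ramp K s \<le> 1"
  by (auto simp: ramp_def)

lemma ramp_mono: "K \<ge> 0 \<Longrightarrow> s \<le> t \<Longrightarrow> ramp K s \<le> ramp K t"
  using mult_left_mono[of s t K] by (auto simp: ramp_def)

lemma ramp_mult_diff_nonneg:
  assumes "K \<ge> 0" shows "(s - t) * (ramp K s - ramp K t) \<ge> 0"
proof (cases "s \<le> t")
  case True
  then show ?thesis using ramp_mono[OF assms, of s t] by (intro mult_nonpos_nonpos) auto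
next
  case False
  then show ?thesis using ramp_mono[OF assms, of t s] by (intro mult_nonneg_nonneg) auto
qed

lemma ramp_diff_le:
  assumes "K \<ge> 0" shows "\<bar>ramp K s - ramp K t\<bar> \<le> min 1 (\<bar>s - t\<bar> * K)"
proof -
  have "\<bar>K * s - K * t\<bar> = \<bar>s - t\<bar> * K"
    using assms by (simp add: right_diff_distrib[symmetric] abs_mult)
  then show ?thesis unfolding ramp_def by linarith
qed

lemma ramp_tendsto_heaviside: "(\<lambda>k. ramp (real (Suc k)) s) \<longlonglongrightarrow> heaviside s"
proof (cases "s > 0")
  case True
  have "\<forall>\<^sub>F k in sequentially. 1 / s \<le> real k"
    using filterlim_real_sequentially unfolding filterlim_at_top by blast
  then have "\<forall>\<^sub>F k in sequentially. ramp (real (Suc k)) s = heaviside s"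
  proof eventually_elim
    case (elim k)
    then have "1 \<le> real (Suc k) * s" using True by (simp add: field_simps)
    then show ?case using True by (simp add: ramp_def heaviside_def)
  qed
  then show ?thesis by (rule tendsto_eventually)
next
  case False
  then have "ramp (real (Suc k)) s = heaviside s" for k
    by (simp add: ramp_def heaviside_def mult_nonneg_nonpos)
  then show ?thesis by simp
qed

lemma open_half_space: "open (half_space \<nu> x0)"
  unfolding half_space_def by (intro open_Collect_less continuous_intros)

lemma test_field_in_Lip_c:
  fixes g \<eta> :: "'a::euclidean_space \<Rightarrow> real"
  assumes g: "\<And>y. 0 \<le> g y" "\<And>y. g y \<le> 1" "r > 0" "\<And>x y. \<bar>g y - g x\<bar> \<le> min 1 (norm (y - x) / r)"
    and \<eta>: "\<And>y. 0 \<le> \<eta> y" "\<And>y. \<eta> y \<le> 1" "R > 0" "\<And>x y. \<bar>\<eta> y - \<eta> x\<bar> \<le> min 1 (norm (y - x) / R)"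
    and S: "bounded S" "\<And>x. x \<notin> S \<Longrightarrow> \<eta> x = 0" and \<nu>: "norm \<nu> = 1"
  shows "(\<lambda>y. (g y * \<eta> y) *\<^sub>R \<nu>) \<in> Lip_c"
proof -
  have "(1 / r + 1 / R)-lipschitz_on UNIV (\<lambda>y. (g y * \<eta> y) *\<^sub>R \<nu>)"
  proof (rule lipschitz_onI)
    fix y x :: 'a
    have "dist ((g y * \<eta> y) *\<^sub>R \<nu>) ((g x * \<eta> x) *\<^sub>R \<nu>) = \<bar>g y * \<eta> y - g x * \<eta> x\<bar>"
      using \<nu> by (simp add: dist_norm scaleR_left_diff_distrib[symmetric])
    also have "\<dots> \<le> \<bar>g y - g x\<bar> + \<bar>\<eta> y - \<eta> x\<bar>" by (rule abs_mult_diff_le[OF g(1,2) \<eta>(1,2)])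
    also have "\<dots> \<le> norm (y - x) / r + norm (y - x) / R" using g(4)[of y x] \<eta>(4)[of y x] by linarith
    also have "\<dots> = (1 / r + 1 / R) * dist y x" by (simp add: dist_norm distrib_right)
    finally show "dist ((g y * \<eta> y) *\<^sub>R \<nu>) ((g x * \<eta> x) *\<^sub>R \<nu>) \<le> (1 / r + 1 / R) * dist y x" .
  next
    show "0 \<le> 1 / r + 1 / R" using g(3) \<eta>(3) by (simp add: add_nonneg_nonneg)
  qed
  moreover have "{y. (g y * \<eta> y) *\<^sub>R \<nu> \<noteq> 0} \<subseteq> S" using S(2) by auto
  then have "bounded {y. (g y * \<eta> y) *\<^sub>R \<nu> \<noteq> 0}" using S(1) bounded_subset by blast
  ultimately show ?thesis unfolding Lip_c_def compactly_supported_def by (auto simp: compact_closure)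
qed

theorem corollary1p9:
  fixes f :: "real ^ 'n \<Rightarrow> real" and D :: "(real ^ 'n) set \<Rightarrow> real ^ 'n"
    and \<alpha> p :: real and x\<^sub>0 \<nu> :: "real ^ 'n"
  assumes "0 < \<alpha>" and "\<alpha> < 1"
    and "1 \<le> p" and "p < real CARD('n) / (real CARD('n) - \<alpha>)"
    and "f \<in> BV_plus \<alpha> p"
    and "is_frac_variation_measure \<alpha> f D"
    and "norm \<nu> = 1"
  shows "ennreal (frac_const 1 \<alpha> / \<alpha>) *
           (\<integral>\<^sup>+ x. ennreal (f x / \<bar>(x - x\<^sub>0) \<bullet> \<nu>\<bar> powr \<alpha>) \<partial>lebesgue)
         \<le> total_variation D (closure (half_space \<nu> x\<^sub>0))"
proof -
  note \<alpha> = assms(1,2) and p = assms(3,4) and \<nu> = assms(7)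
  have f: "f \<in> Lp p" and fpos: "AE x in lebesgue. f x \<ge> 0"
    using assms(5) by (auto simp: BV_plus_def BV_def)
  have D: "finite_radon_measure D"
    and test: "\<And>\<phi>. \<phi> \<in> Lip_c \<Longrightarrow> (LINT x|lebesgue. f x * frac_div \<alpha> \<phi> x) = - vector_integral D \<phi>"
    using assms(6) by (auto simp: is_frac_variation_measure_def)
  have fm[measurable]: "f \<in> borel_measurable lebesgue" using f by (simp add: Lp_def)
  define H where "H = half_space \<nu> x\<^sub>0"
  have Hm: "H \<in> sets borel" unfolding H_def by (intro borel_open open_half_space)
  define T where "T = total_variation D H"
  have "total_variation D UNIV < \<infinity>" using D by (simp add: finite_radon_measure_def)
  then have T_fin: "T < \<infinity>"
    unfolding T_def using total_variation_mono[OF Hm, of UNIV D] by (simp add: le_less_trans)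
  have T_le: "T \<le> total_variation D (closure H)"
    unfolding T_def by (intro total_variation_mono Hm borel_closed closure_subset) simp
  define \<mu> where "\<mu> = frac_const CARD('n) \<alpha>"
  have \<mu>: "\<mu> > 0" unfolding \<mu>_def by (rule frac_const_pos[OF \<alpha>])
  \<comment> \<open>One parameter is both the slope of the ramp and the radius of the cutoff: the
    error term does not see the slope, so the two rates need no balancing. \<open>Suc\<close> keeps
    it positive.\<close>
  define K where "K k = real (Suc k)" for k
  have K: "K k > 0" for k by (simp add: K_def)
  define g where "g k y = ramp (K k) ((y - x\<^sub>0) \<bullet> \<nu>)" for k y
  define \<eta> where "\<eta> k = (cutoff (K k) :: real ^ 'n \<Rightarrow> real)" for k
  define I where "I k = (\<integral>\<^sup>+x. ennreal \<bar>f x\<bar> * nonlocal_gradient \<alpha> (\<eta> k) x \<partial>lebesgue)" for k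
  define q where "q k x y = (y - x) \<bullet> \<nu> * (g k y - g k x) / norm (y - x) powr (real CARD('n) + \<alpha> + 1)" for k x y
  define G where "G k x = (\<integral>\<^sup>+y. ennreal (q k x y) \<partial>lborel)" for k x
  have [measurable]: "g k \<in> borel_measurable borel" for k unfolding g_def[abs_def] by measurable
  have [measurable]: "\<eta> k \<in> borel_measurable borel" for k unfolding \<eta>_def by measurable
  have [measurable]: "G k \<in> borel_measurable borel" for k
    unfolding G_def[abs_def] q_def by measurable
  have g: "0 \<le> g k y" "g k y \<le> 1" for k y by (simp_all add: g_def ramp_range)
  have g_lip: "\<bar>g k y - g k x\<bar> \<le> min 1 (norm (y - x) / (1 / K k))" for k x y
  proof -
    have "\<bar>(y - x\<^sub>0) \<bullet> \<nu> - (x - x\<^sub>0) \<bullet> \<nu>\<bar> \<le> norm (y - x)"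
      using Cauchy_Schwarz_ineq2[of "y - x" \<nu>] \<nu> by (simp add: inner_diff_left)
    then have "\<bar>(y - x\<^sub>0) \<bullet> \<nu> - (x - x\<^sub>0) \<bullet> \<nu>\<bar> * K k \<le> norm (y - x) * K k"
      using K[of k] by (intro mult_right_mono) auto
    moreover have "\<bar>g k y - g k x\<bar> \<le> min 1 (\<bar>(y - x\<^sub>0) \<bullet> \<nu> - (x - x\<^sub>0) \<bullet> \<nu>\<bar> * K k)"
      unfolding g_def using K[of k] by (intro ramp_diff_le) simp
    moreover have "norm (y - x) / (1 / K k) = norm (y - x) * K k" by simp
    ultimately show ?thesis by linarith
  qed
  have g_mono: "(y - x) \<bullet> \<nu> * (g k y - g k x) \<ge> 0" for k x y
    using ramp_mult_diff_nonneg[of "K k" "(y - x\<^sub>0) \<bullet> \<nu>" "(x - x\<^sub>0) \<bullet> \<nu>"] K[of k]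
    by (simp add: g_def inner_diff_left)
  have \<eta>: "0 \<le> \<eta> k y" "\<eta> k y \<le> 1" for k y by (simp_all add: \<eta>_def cutoff_range)
  have \<eta>_lip: "\<bar>\<eta> k y - \<eta> k x\<bar> \<le> min 1 (norm (y - x) / K k)" for k x y
    unfolding \<eta>_def by (rule cutoff_diff_le[OF K])
  have \<eta>_supp: "x \<notin> cball 0 (2 * K k) \<Longrightarrow> \<eta> k x = 0" for k x
    unfolding \<eta>_def by (rule cutoff_eq_0[OF K])

  have upper: "(\<integral>\<^sup>+x. ennreal (f x * \<mu> * \<eta> k x) * G k x \<partial>lebesgue) \<le> T + ennreal \<mu> * I k" for k
  proof -
    have "(\<integral>\<^sup>+x. ennreal (f x * \<mu> * \<eta> k x) * G k x \<partial>lebesgue)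
      \<le> ennreal (LINT x|lebesgue. f x * frac_div \<alpha> (\<lambda>y. (g k y * \<eta> k y) *\<^sub>R \<nu>) x) + ennreal \<mu> * I k"
      unfolding \<mu>_def G_def q_def I_def
    proof (rule monotone_test_field_le[OF \<alpha> p(1) f fpos \<nu> _ g _ g_lip g_mono _ \<eta> K \<eta>_lip _ _ \<eta>_supp])
      show "0 < 1 / K k" using K[of k] by simp
      show "emeasure lborel (cball (0 :: real ^ 'n) (2 * K k)) < \<infinity>"
        by (rule emeasure_lborel_cball_finite)
    qed measurable
    also have "(LINT x|lebesgue. f x * frac_div \<alpha> (\<lambda>y. (g k y * \<eta> k y) *\<^sub>R \<nu>) x)
      = - vector_integral D (\<lambda>y. (g k y * \<eta> k y) *\<^sub>R \<nu>)"
      using K[of k] by (intro test test_field_in_Lip_c[OF g _ g_lip \<eta> K \<eta>_lip bounded_cball \<eta>_supp \<nu>]) simp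
    also have "- vector_integral D (\<lambda>y. (g k y * \<eta> k y) *\<^sub>R \<nu>) \<le> enn2real T"
    proof -
      have "\<bar>vector_integral D (\<lambda>y. (g k y * \<eta> k y) *\<^sub>R \<nu>)\<bar> \<le> enn2real T"
        unfolding T_def
      proof (rule vector_integral_le_total_variation[OF D Hm])
        show "(\<lambda>y. g k y * \<eta> k y) \<in> borel_measurable borel" by measurable
        show "0 \<le> g k x * \<eta> k x" "g k x * \<eta> k x \<le> 1" for x
          using g \<eta> by (auto intro: mult_le_one)
        show "g k x * \<eta> k x = 0" if "x \<notin> H" for x
        proof -
          have "(x - x\<^sub>0) \<bullet> \<nu> \<le> 0" using that by (simp add: H_def half_space_def)
          then have "K k * ((x - x\<^sub>0) \<bullet> \<nu>) \<le> 0" using K[of k] by (intro mult_nonneg_nonpos) auto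
          then show ?thesis by (simp add: g_def ramp_def)
        qed
      qed (simp add: \<nu>)
      then show ?thesis by linarith
    qed
    then have "ennreal (- vector_integral D (\<lambda>y. (g k y * \<eta> k y) *\<^sub>R \<nu>)) + ennreal \<mu> * I k \<le> T + ennreal \<mu> * I k"
      using T_fin by (intro add_right_mono) (metis ennreal_enn2real ennreal_leI infinity_ennreal_def)
    finally show ?thesis .
  qed

  have "I \<longlonglongrightarrow> 0"
    using nonlocal_gradient_cutoff_tendsto_0[OF \<alpha> p f] unfolding I_def[abs_def] \<eta>_def K_def .
  then have "(\<lambda>k. T + ennreal \<mu> * I k) \<longlonglongrightarrow> T + ennreal \<mu> * 0"
    by (intro tendsto_add tendsto_const ennreal_tendsto_cmult) simp_all
  then have lim: "liminf (\<lambda>k. T + ennreal \<mu> * I k) = T"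
    by (intro lim_imp_Liminf) simp_all

  \<comment> \<open>On the hyperplane through x0 the left-hand side is 0, because
    \<open>0 powr \<alpha>\<close> is 0 and so is a quotient with denominator 0.\<close>
  have lower: "ennreal (frac_const 1 \<alpha> / \<alpha>) * ennreal (f x / \<bar>(x - x\<^sub>0) \<bullet> \<nu>\<bar> powr \<alpha>)
      \<le> liminf (\<lambda>k. ennreal (f x * \<mu> * \<eta> k x) * G k x)" if fx: "f x \<ge> 0" for x
  proof (cases "(x - x\<^sub>0) \<bullet> \<nu> = 0")
    case False
    let ?N = "\<lambda>y. norm (y - x) powr (real CARD('n) + \<alpha> + 1)"
    let ?h = "\<lambda>y. (y - x) \<bullet> \<nu> * (heaviside ((y - x\<^sub>0) \<bullet> \<nu>) - heaviside ((x - x\<^sub>0) \<bullet> \<nu>)) / ?N y"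
    have c: "0 < frac_const 1 \<alpha> / \<alpha>" using frac_const_pos[OF \<alpha>, of 1] \<alpha> by simp
    have "ennreal (frac_const 1 \<alpha> / \<alpha>) * ennreal (f x / \<bar>(x - x\<^sub>0) \<bullet> \<nu>\<bar> powr \<alpha>)
      = ennreal (f x) * ennreal (frac_const 1 \<alpha> / \<alpha> * \<bar>(x - x\<^sub>0) \<bullet> \<nu>\<bar> powr (- \<alpha>))"
      unfolding ennreal_mult'[OF less_imp_le[OF c], symmetric] ennreal_mult'[OF fx, symmetric]
      by (simp add: powr_minus divide_inverse mult_ac)
    also have "\<dots> = ennreal (f x) * (ennreal \<mu> * (\<integral>\<^sup>+y. ennreal (?h y) \<partial>lborel))"
      unfolding \<mu>_def by (subst nn_integral_half_space_gradient[OF \<alpha> \<nu> False]) (rule refl)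
    also have "\<dots> = ennreal (f x * \<mu>) * (\<integral>\<^sup>+y. ennreal (?h y) \<partial>lborel)"
      using fx \<mu> by (simp add: ennreal_mult mult.assoc)
    also have "\<dots> = (\<integral>\<^sup>+y. ennreal (f x * \<mu>) * ennreal (?h y) \<partial>lborel)"
      by (rule nn_integral_cmult[symmetric]) measurable
    \<comment> \<open>The convergence holds for every y, including those on the hyperplane, since
      all ramps and \<open>heaviside\<close> vanish at 0.\<close>
    also have "\<dots> = (\<integral>\<^sup>+y. liminf (\<lambda>k. ennreal (f x * \<mu>) * ennreal (q k x y)) \<partial>lborel)"
    proof (rule nn_integral_cong)
      fix y
      have "(\<lambda>k. q k x y) \<longlonglongrightarrow> ?h y"
        unfolding q_def g_def K_def divide_inverse
        by (intro tendsto_mult_right tendsto_mult_left tendsto_diff ramp_tendsto_heaviside)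
      then have "(\<lambda>k. ennreal (f x * \<mu>) * ennreal (q k x y)) \<longlonglongrightarrow> ennreal (f x * \<mu>) * ennreal (?h y)"
        by (intro ennreal_tendsto_cmult tendsto_ennrealI) simp_all
      then show "ennreal (f x * \<mu>) * ennreal (?h y) = liminf (\<lambda>k. ennreal (f x * \<mu>) * ennreal (q k x y))"
        by (intro lim_imp_Liminf[symmetric]) simp_all
    qed
    also have "\<dots> \<le> liminf (\<lambda>k. \<integral>\<^sup>+y. ennreal (f x * \<mu>) * ennreal (q k x y) \<partial>lborel)"
      by (rule nn_integral_liminf) (simp add: q_def)
    also have "\<dots> = liminf (\<lambda>k. ennreal (f x * \<mu>) * G k x)"
      unfolding G_def by (subst nn_integral_cmult) (simp_all add: q_def)
    \<comment> \<open>At a fixed x the cutoff is eventually 1, so it can be inserted without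
      changing the lower limit.\<close>
    also have "\<dots> = liminf (\<lambda>k. ennreal (f x * \<mu> * \<eta> k x) * G k x)"
    proof (rule Liminf_eq)
      have "\<forall>\<^sub>F k in sequentially. norm x \<le> real k"
    using filterlim_real_sequentially unfolding filterlim_at_top by blast
      then show "\<forall>\<^sub>F k in sequentially. ennreal (f x * \<mu>) * G k x = ennreal (f x * \<mu> * \<eta> k x) * G k x"
      proof eventually_elim
        case (elim k)
        then have "\<eta> k x = 1" unfolding \<eta>_def by (intro cutoff_eq_1 K) (simp add: K_def)
        then show ?case by simp
      qed
    qed
    finally show ?thesis .
  qed simp

  have lebm: "h \<in> borel_measurable lebesgue" if "h \<in> borel_measurable borel" for h :: "real ^ 'n \<Rightarrow> 'b::topological_space"
    using that by (simp add: measurable_completion)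
  have [measurable]: "\<eta> k \<in> borel_measurable lebesgue" "G k \<in> borel_measurable lebesgue" for k
    by (rule lebm, measurable)+
  have [measurable]: "(\<lambda>x. \<bar>(x - x\<^sub>0) \<bullet> \<nu>\<bar> powr \<alpha>) \<in> borel_measurable lebesgue"
    by (rule lebm) measurable
  have "ennreal (frac_const 1 \<alpha> / \<alpha>) * (\<integral>\<^sup>+ x. ennreal (f x / \<bar>(x - x\<^sub>0) \<bullet> \<nu>\<bar> powr \<alpha>) \<partial>lebesgue)
     = (\<integral>\<^sup>+ x. ennreal (frac_const 1 \<alpha> / \<alpha>) * ennreal (f x / \<bar>(x - x\<^sub>0) \<bullet> \<nu>\<bar> powr \<alpha>) \<partial>lebesgue)"
    by (rule nn_integral_cmult[symmetric]) measurable
  also have "\<dots> \<le> (\<integral>\<^sup>+x. liminf (\<lambda>k. ennreal (f x * \<mu> * \<eta> k x) * G k x) \<partial>lebesgue)"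
    by (rule nn_integral_mono_AE, rule eventually_mono[OF fpos], rule lower)
  also have "\<dots> \<le> liminf (\<lambda>k. \<integral>\<^sup>+x. ennreal (f x * \<mu> * \<eta> k x) * G k x \<partial>lebesgue)"
    by (rule nn_integral_liminf) measurable
  also have "\<dots> \<le> liminf (\<lambda>k. T + ennreal \<mu> * I k)"
    by (intro Liminf_mono always_eventually allI upper)
  also have "\<dots> \<le> total_variation D (closure (half_space \<nu> x\<^sub>0))"
    unfolding lim using T_le by (simp add: H_def)
  finally show ?thesis .
qed

end
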